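(* Let $k$ be a field and let $S=\mathrm{Cox}(\mathbb{P}^{n_1}\times\dots\times\mathbb{P}^{n_s})=k[x_{1,0},\dots,x_{1,n_1},\dots,x_{s,0},\dots,x_{s,n_s}]$ with its $\mathbb{Z}^s$-grading. Let $I\subseteq S$ be an ideal, homogeneous with respect to the $\mathbb{Z}^s$-grading. Let $m\in\mathbb{N}$, let $(d_1,\dots,d_s)\in\mathbb{Z}_{\geq 1}^s$ with $d_i\geq m$ for all $i$, and suppose that $I$ is generated in degrees $\leq(d_1,\dots,d_s)$. Let $$\mathcal{B}=\{(b_1,\dots,b_s)\in\mathbb{N}^s\mid b_i\in\{d_i,d_i+1\}\text{ for all }i\}.$$ If $H_I(b_1,\dots,b_s)=m$ for all $(b_1,\dots,b_s)\in\mathcal{B}$, then $H_I(u_1,\dots,u_s)=m$ for all $(u_1,\dots,u_s)\in(d_1,\dots,d_s)+\mathbb{N}^s$. It follows that $P_I(t_1,\dots,t_s)=m$.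
   Context: Here $\mathbb{N}$ includes $0$. The $\mathbb{Z}^s$-grading on $S$ is given by $\deg(x_{i,j})=\mathbf{e}_i$, the $i$-th standard basis vector of $\mathbb{Z}^s$. "Generated in degrees $\leq(d_1,\dots,d_s)$" means that $I$ has a homogeneous generating set each of whose elements has degree $\leq(d_1,\dots,d_s)$ componentwise. The Hilbert function is $H_I(u_1,\dots,u_s)=\dim_k (S/I)_{(u_1,\dots,u_s)}$ for $(u_1,\dots,u_s)\in\mathbb{N}^s$. The Hilbert polynomial $P_I(t_1,\dots,t_s)\in\mathbb{Q}[t_1,\dots,t_s]$ is the unique polynomial with $P_I(u_1,\dots,u_s)=H_I(u_1,\dots,u_s)$ whenever all $u_i$ are sufficiently large. *)

theory Defs
  imports
    "HOL-Library.Poly_Mapping"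
    "HOL-Algebra.QuotRing"
    "Jordan_Normal_Form.VS_Connect"
begin

text \<open>The variable \<open>x\<^sub>i\<^sub>,\<^sub>j\<close> is the pair \<open>(i, j)\<close>; a monomial is its exponent vector.
  The type below has infinitely many variables; the ring \<open>S\<close> is cut out of it by its carrier.\<close>

type_synonym monomial = "(nat \<times> nat) \<Rightarrow>\<^sub>0 nat"
type_synonym 'k cox_poly = "monomial \<Rightarrow>\<^sub>0 'k"

definition cox_vars :: "nat \<Rightarrow> (nat \<Rightarrow> nat) \<Rightarrow> (nat \<times> nat) set" where
  "cox_vars s n = {(i, j). i \<in> {1..s} \<and> j \<le> n i}"

definition cox_ring :: "nat \<Rightarrow> (nat \<Rightarrow> nat) \<Rightarrow> ('k::field) cox_poly ring" where
  "cox_ring s n =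
    \<lparr>carrier = {p. \<forall>t\<in>Poly_Mapping.keys p. Poly_Mapping.keys t \<subseteq> cox_vars s n},
     mult = (*), one = 1, zero = 0, add = (+)\<rparr>"

definition multideg :: "monomial \<Rightarrow> nat \<Rightarrow> int" where
  "multideg t i = (\<Sum>x\<in>Poly_Mapping.keys t. int (Poly_Mapping.lookup t x) * of_bool (fst x = i))"

text \<open>An element \<open>a\<close> of \<open>\<int>\<^sup>s\<close> is a function of which only the values at \<open>1, \<dots>, s\<close> matter.\<close>

definition cox_piece :: "nat \<Rightarrow> (nat \<Rightarrow> nat) \<Rightarrow> (nat \<Rightarrow> int) \<Rightarrow> ('k::field) cox_poly set" where
  "cox_piece s n a = {p \<in> carrier (cox_ring s n).
     \<forall>t\<in>Poly_Mapping.keys p. \<forall>i\<in>{1..s}. multideg t i = a i}"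

definition hom_component :: "nat \<Rightarrow> (nat \<Rightarrow> int) \<Rightarrow> ('k::field) cox_poly \<Rightarrow> 'k cox_poly" where
  "hom_component s a p =
    (\<Sum>t | t \<in> Poly_Mapping.keys p \<and> (\<forall>i\<in>{1..s}. multideg t i = a i).
       Poly_Mapping.single t (Poly_Mapping.lookup p t))"

definition homogeneous_ideal :: "nat \<Rightarrow> (nat \<Rightarrow> nat) \<Rightarrow> ('k::field) cox_poly set \<Rightarrow> bool" where
  "homogeneous_ideal s n I \<longleftrightarrow>
     ideal I (cox_ring s n) \<and> (\<forall>p\<in>I. \<forall>a. hom_component s a p \<in> I)"

definition generated_in_degrees_le ::
    "nat \<Rightarrow> (nat \<Rightarrow> nat) \<Rightarrow> (nat \<Rightarrow> int) \<Rightarrow> ('k::field) cox_poly set \<Rightarrow> bool" where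
  "generated_in_degrees_le s n d I \<longleftrightarrow>
     (\<exists>G \<subseteq> carrier (cox_ring s n).
        (\<forall>g\<in>G. \<exists>a. g \<in> cox_piece s n a \<and> (\<forall>i\<in>{1..s}. a i \<le> d i)) \<and>
        I = genideal (cox_ring s n) G)"

text \<open>The graded piece \<open>(S/I)\<^sub>a\<close>, i.e. the image of \<open>S\<^sub>a\<close> in \<open>S/I\<close>, as a \<open>k\<close>-vector space. The fields
  \<open>mult\<close> and \<open>one\<close> are present only because the record type of modules extends that of rings.\<close>

definition quot_piece ::
    "nat \<Rightarrow> (nat \<Rightarrow> nat) \<Rightarrow> ('k::field) cox_poly set \<Rightarrow> (nat \<Rightarrow> int) \<Rightarrow> ('k, 'k cox_poly set) module" where
  "quot_piece s n I a = (let S = cox_ring s n; Q = S Quot I in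
    \<lparr>carrier = (\<lambda>p. I +>\<^bsub>S\<^esub> p) ` cox_piece s n a,
     mult = mult Q, one = one Q, zero = zero Q, add = add Q,
     smult = (\<lambda>c X. (I +>\<^bsub>S\<^esub> Poly_Mapping.single 0 c) \<otimes>\<^bsub>Q\<^esub> X)\<rparr>)"

definition hilbert_fun ::
    "nat \<Rightarrow> (nat \<Rightarrow> nat) \<Rightarrow> ('k::field) cox_poly set \<Rightarrow> (nat \<Rightarrow> nat) \<Rightarrow> nat" where
  "hilbert_fun s n I u =
     vectorspace.dim (class_ring :: 'k ring) (quot_piece s n I (\<lambda>i. int (u i)))"

text \<open>The ring \<open>\<rat>[t\<^sub>1, \<dots>, t\<^sub>s]\<close> and evaluation of its elements.\<close>

type_synonym rat_mpoly = "(nat \<Rightarrow>\<^sub>0 nat) \<Rightarrow>\<^sub>0 rat"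

definition rat_mpolys :: "nat \<Rightarrow> rat_mpoly set" where
  "rat_mpolys s = {P. \<forall>t\<in>Poly_Mapping.keys P. Poly_Mapping.keys t \<subseteq> {1..s}}"

definition eval_mpoly :: "rat_mpoly \<Rightarrow> (nat \<Rightarrow> rat) \<Rightarrow> rat" where
  "eval_mpoly P v = (\<Sum>t\<in>Poly_Mapping.keys P. Poly_Mapping.lookup P t *
     (\<Prod>i\<in>Poly_Mapping.keys t. v i ^ Poly_Mapping.lookup t i))"

definition hilbert_poly :: "nat \<Rightarrow> (nat \<Rightarrow> nat) \<Rightarrow> ('k::field) cox_poly set \<Rightarrow> rat_mpoly" where
  "hilbert_poly s n I = (THE P. P \<in> rat_mpolys s \<and>
     (\<exists>N. \<forall>u. (\<forall>i\<in>{1..s}. N \<le> u i) \<longrightarrow>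
        eval_mpoly P (\<lambda>i. of_nat (u i)) = of_nat (hilbert_fun s n I u)))"

end

theory Submission
  imports Defs "HOL-Library.Function_Algebras" "HOL-Computational_Algebra.Polynomial_Factorial"
begin

text \<open>Only one of the \<open>s\<close> degrees needs to vary at a time. Suppose that the Hilbert function takes the value
  \<open>m\<close> at \<open>u\<close> and at \<open>u + e\<^sub>i\<close>, where \<open>u \<ge> d\<close> and \<open>u\<^sub>i \<ge> m\<close>. Then it takes the value \<open>m\<close> at all
  \<open>u + a e\<^sub>i\<close> with \<open>a \<ge> 0\<close> (\<open>hilbert_fun_persistence\<close>). Applied to the directions one after the other, this carries
  the value \<open>m\<close> from the cube to all of \<open>d + \<nat>\<^sup>s\<close>.

  For a single direction the argument is dual. The piece \<open>(S/I)\<^sub>u\<close> is replaced by the functions on the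
  monomials of degree \<open>u\<close> that annihilate \<open>I\<close> (the inverse system of Macaulay), and multiplication by a
  variable by the contraction \<open>\<phi> \<mapsto> (t \<mapsto> \<phi> (t x\<^sub>v))\<close>. Quotients become subspaces, and generation in
  degrees \<open>\<le> d\<close> becomes a gluing principle: in degree \<open>u + e\<^sub>i\<close> with \<open>u \<ge> d\<close>, a function belongs to the
  inverse system as soon as its contractions by the variables of the \<open>i\<close>-th group do
  (\<open>inverse_system_glue\<close>).

  Two facts then give persistence. First, on a space of functions of degree \<open>d\<close> whose dimension is at
  most \<open>d\<close>, almost every linear form acts injectively by contraction (\<open>finite_noninjective_forms\<close>). So
  some linear form \<open>L\<close> acts injectively in degree \<open>u\<^sub>i\<close>, hence in all higher degrees, and it maps degree
  \<open>u\<^sub>i + 1\<close> onto degree \<open>u\<^sub>i\<close> since the dimensions agree. Secondly, surjectivity of \<open>L\<close> propagates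
  upwards (\<open>inverse_system_persistence\<close>): the contractions of \<open>\<phi>\<close> by the variables can be lifted through
  \<open>L\<close>, the lifts are compatible because \<open>L\<close> is injective, so they come from one function, which lies in
  the inverse system by gluing and is mapped to \<open>\<phi>\<close>.

  The first fact requires an infinite field. The functions are therefore given values in \<open>k(z)\<close>, which
  does not change dimensions (\<open>dim_inverse_system\<close>). The Hilbert polynomial is constant because a
  polynomial is determined by its values at all large points (\<open>rat_mpoly_eqI_eventually\<close>).\<close>

section \<open>Dimensions of subspaces with a finite spanning set\<close>

text \<open>The dimensions below are those of subspaces of an infinite-dimensional space of functions, so
  finiteness enters through a finite set whose span contains the subspace.\<close>

context vector_space
begin

lemma dim_subset_finite_span:
  assumes "finite F" "B \<subseteq> span F" "A \<subseteq> B"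
  shows "dim A \<le> dim B"
proof -
  obtain C where C: "C \<subseteq> B" "independent C" "B \<subseteq> span C" "card C = dim B"
    using basis_exists .
  have "finite C" using independent_span_bound[OF assms(1) C(2)] C(1) assms(2) by auto
  then show ?thesis using dim_le_card[of A C] C assms by auto
qed

lemma subspace_eq_of_dim_ge:
  assumes "finite F" "B \<subseteq> span F" "subspace A" "A \<subseteq> B" "dim B \<le> dim A"
  shows "A = B"
proof (rule ccontr)
  assume "A \<noteq> B"
  then obtain b where b: "b \<in> B" "b \<notin> A" using assms by auto
  obtain C where C: "C \<subseteq> A" "independent C" "A \<subseteq> span C" "card C = dim A"
    using basis_exists .
  have sp: "span C = A" using C assms(3) by (simp add: span_subspace)
  have fC: "finite C" using independent_span_bound[OF assms(1) C(2)] C(1) assms(2,4) by auto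
  have ind: "independent (insert b C)" using b sp C(2) independent_insertI by auto
  obtain D where D: "D \<subseteq> B" "independent D" "B \<subseteq> span D" "card D = dim B"
    using basis_exists .
  have fD: "finite D" using independent_span_bound[OF assms(1) D(2)] D(1) assms(2) by auto
  have "card (insert b C) \<le> card D"
    using independent_span_bound[OF fD ind] b D C(1) assms(4) by auto
  moreover have "b \<notin> C" using b C(1) by auto
  ultimately show False using fC C(4) D(4) assms(5) by simp
qed

lemma dim_image_of_inj:
  assumes "finite F" "A \<subseteq> span F" "subspace A" and f: "Vector_Spaces.linear scale scale f"
    and inj: "\<And>x. x \<in> A \<Longrightarrow> f x = 0 \<Longrightarrow> x = 0"
  shows "dim (f ` A) = dim A"
proof -
  interpret vector_space_pair scale scale by unfold_locales
  obtain C where C: "C \<subseteq> A" "independent C" "A \<subseteq> span C" "card C = dim A"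
    using basis_exists .
  have sp: "span C = A" using C assms(3) by (simp add: span_subspace)
  have inj': "inj_on f (span C)"
    unfolding sp using linear_inj_on_iff_eq_0[OF f assms(3)] inj by blast
  have "independent (f ` C)" using linear_independent_injective_image[OF f C(2)] inj' by blast
  moreover have "f ` A = span (f ` C)" using linear_span_image[OF f] sp by auto
  ultimately have "dim (f ` A) = card (f ` C)" by (simp add: dim_eq_card)
  then show ?thesis using C(4) card_image[of f C] inj' span_superset inj_on_subset by metis
qed

lemma dim_image_less_of_kernel:
  assumes "finite F" "A \<subseteq> span F" "subspace A" and f: "Vector_Spaces.linear scale scale f"
    and x: "x \<in> A" "x \<noteq> 0" "f x = 0"
  shows "dim (f ` A) < dim A"
proof -
  interpret vector_space_pair scale scale by unfold_locales
  have "independent {x}" using x by simp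
  then obtain C where C: "{x} \<subseteq> C" "C \<subseteq> A" "independent C" "A \<subseteq> span C"
    using maximal_independent_subset_extend[of "{x}" A] x(1) by auto
  have fC: "finite C" using independent_span_bound[OF assms(1) C(3)] C(2) assms(2) by auto
  have sp: "span C = A" using C assms(3) by (simp add: span_subspace)
  have "f ` A = span (f ` C)" using linear_span_image[OF f] sp by auto
  also have "f ` C = insert 0 (f ` (C - {x}))" using C x by auto
  finally have "dim (f ` A) = dim (f ` (C - {x}))" by (metis dim_span span_insert_0)
  also have "\<dots> \<le> card (f ` (C - {x}))" using dim_le_card' fC by simp
  also have "\<dots> \<le> card (C - {x})" using card_image_le fC by blast
  also have "\<dots> < card C" using C(1) fC by (meson card_Diff1_less insert_subset)
  also have "card C = dim A" using C basis_card_eq_dim by auto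
  finally show ?thesis .
qed

end

section \<open>Contraction of functions on monomials\<close>

text \<open>A function on the monomials of a given degree is a linear form on the polynomials of that degree.
  Under this duality the transpose of multiplication by a variable is a shift of the argument, and
  the transpose of multiplication by a linear form is a combination of such shifts.\<close>

interpretation funsp: vector_space "\<lambda>(c::'k::field) (\<phi>::'a \<Rightarrow> 'k) t. c * \<phi> t"
  by unfold_locales (auto simp: fun_eq_iff algebra_simps)

definition contract :: "'v \<Rightarrow> (('v \<Rightarrow>\<^sub>0 nat) \<Rightarrow> 'k::field) \<Rightarrow> ('v \<Rightarrow>\<^sub>0 nat) \<Rightarrow> 'k" where
  "contract v \<phi> t = \<phi> (t + Poly_Mapping.single v 1)"

definition deg_in :: "'v set \<Rightarrow> ('v \<Rightarrow>\<^sub>0 nat) \<Rightarrow> nat" where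
  "deg_in J t = (\<Sum>v\<in>J. Poly_Mapping.lookup t v)"

definition homog :: "'v set \<Rightarrow> nat \<Rightarrow> (('v \<Rightarrow>\<^sub>0 nat) \<Rightarrow> 'k::field) set" where
  "homog J a = {\<phi>. \<forall>t. \<phi> t \<noteq> 0 \<longrightarrow> deg_in J t = a}"

text \<open>Transpose of the multiplication by the linear form \<open>\<Sum>\<^sub>v c\<^bsup>w v\<^esup> x\<^sub>v\<close>. The coefficients lie on a
  rational curve in order that a single scalar \<open>c\<close> parametrises the linear forms: when the exponents
  \<open>w v\<close> are distinct, infinitely many points of the curve span all linear forms, so that genericity
  becomes a statement about polynomials in \<open>c\<close>.\<close>
definition contract_form ::
    "'v set \<Rightarrow> ('v \<Rightarrow> nat) \<Rightarrow> 'k \<Rightarrow> (('v \<Rightarrow>\<^sub>0 nat) \<Rightarrow> 'k::field) \<Rightarrow> ('v \<Rightarrow>\<^sub>0 nat) \<Rightarrow> 'k" where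
  "contract_form J w c \<phi> t = (\<Sum>v\<in>J. c ^ w v * contract v \<phi> t)"

lemma linear_contract: "Vector_Spaces.linear (\<lambda>c \<phi> t. c * \<phi> t) (\<lambda>c \<phi> t. c * \<phi> t) (contract v)"
  unfolding Vector_Spaces.linear_iff
  by (auto simp: contract_def fun_eq_iff intro: funsp.vector_space_axioms)

lemma linear_contract_form:
  "Vector_Spaces.linear (\<lambda>c \<phi> t. c * \<phi> t) (\<lambda>c \<phi> t. c * \<phi> t) (contract_form J w c)"
  unfolding Vector_Spaces.linear_iff
  by (auto simp: contract_form_def contract_def fun_eq_iff sum.distrib algebra_simps
      sum_distrib_left intro: funsp.vector_space_axioms)

lemma contract_commute: "contract u (contract v \<phi>) = contract v (contract u \<phi>)"
  by (simp add: contract_def fun_eq_iff ac_simps)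

lemma contract_contract_form:
  "contract v (contract_form J w c \<phi>) = contract_form J w c (contract v \<phi>)"
  by (simp add: contract_form_def contract_def fun_eq_iff ac_simps)

lemma contract_form_commute:
  "contract_form J w c (contract_form J w b \<phi>) = contract_form J w b (contract_form J w c \<phi>)"
proof
  fix t
  have "contract_form J w c (contract_form J w b \<phi>) t =
      (\<Sum>v\<in>J. \<Sum>u\<in>J. c ^ w v * (b ^ w u * contract u (contract v \<phi>) t))"
    by (simp add: contract_form_def contract_def sum_distrib_left ac_simps)
  also have "\<dots> = (\<Sum>u\<in>J. \<Sum>v\<in>J. b ^ w u * (c ^ w v * contract v (contract u \<phi>) t))"
    by (subst sum.swap) (simp add: contract_commute mult.left_commute)
  also have "\<dots> = contract_form J w b (contract_form J w c \<phi>) t"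
    by (simp add: contract_form_def contract_def sum_distrib_left ac_simps)
  finally show "contract_form J w c (contract_form J w b \<phi>) t =
    contract_form J w b (contract_form J w c \<phi>) t" .
qed

lemma deg_in_add: "deg_in J (s + t) = deg_in J s + deg_in J t"
  by (simp add: deg_in_def lookup_add sum.distrib)

lemma deg_in_single: "finite J \<Longrightarrow> v \<in> J \<Longrightarrow> deg_in J (Poly_Mapping.single v 1) = 1"
  by (simp add: deg_in_def lookup_single when_def)

lemma contract_homog:
  "finite J \<Longrightarrow> v \<in> J \<Longrightarrow> \<phi> \<in> homog J (Suc a) \<Longrightarrow> contract v \<phi> \<in> homog J a"
  using deg_in_single[of J v] by (fastforce simp: homog_def contract_def deg_in_add)

lemma contract_form_homog:
  assumes "finite J" "\<phi> \<in> homog J (Suc a)"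
  shows "contract_form J w c \<phi> \<in> homog J a"
  unfolding homog_def
proof (intro CollectI allI impI)
  fix t assume "contract_form J w c \<phi> t \<noteq> 0"
  then obtain v where "v \<in> J" "contract v \<phi> t \<noteq> 0"
    unfolding contract_form_def by (metis (no_types, lifting) mult_zero_right sum.neutral)
  then show "deg_in J t = a" using contract_homog[OF assms(1) _ assms(2)] by (auto simp: homog_def)
qed

lemma monomial_factor:
  assumes "Poly_Mapping.lookup t v \<noteq> (0::nat)"
  shows "t - Poly_Mapping.single v 1 + Poly_Mapping.single v 1 = t"
  using assms by (intro poly_mapping_eqI) (auto simp: lookup_add lookup_minus lookup_single when_def)

lemma deg_in_pos_factor:
  assumes "deg_in J t = Suc a"
  obtains v where "v \<in> J" "Poly_Mapping.lookup t v \<noteq> 0"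
  using assms unfolding deg_in_def by (metis Zero_not_Suc sum.neutral)

text \<open>The dual of the fact that in positive degree every monomial is divisible by some variable.\<close>
lemma zero_if_contractions_zero:
  assumes "\<phi> \<in> homog J (Suc a)" "\<And>v. v \<in> J \<Longrightarrow> contract v \<phi> = 0"
  shows "\<phi> = 0"
proof (rule ccontr)
  assume "\<phi> \<noteq> 0"
  then obtain t where t: "\<phi> t \<noteq> 0" by (auto simp: fun_eq_iff)
  then have "deg_in J t = Suc a" using assms(1) by (auto simp: homog_def)
  then obtain v where v: "v \<in> J" "Poly_Mapping.lookup t v \<noteq> 0" by (rule deg_in_pos_factor)
  have "contract v \<phi> (t - Poly_Mapping.single v 1) = \<phi> t"
    using monomial_factor[OF v(2)] by (simp add: contract_def)
  then show False using assms(2)[OF v(1)] t by simp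
qed

text \<open>At each monomial, the value of the contraction by the linear form with parameter \<open>c\<close> is a
  polynomial in \<open>c\<close> whose coefficients are the contractions by the single variables; if it vanishes
  for infinitely many \<open>c\<close>, all of its coefficients vanish.\<close>
lemma contractions_zero_if_forms_zero:
  assumes "finite J" "inj_on w J" "infinite {c. contract_form J w c \<phi> = 0}" "v \<in> J"
  shows "contract v \<phi> = 0"
proof
  fix t
  define p where "p = (\<Sum>u\<in>J. Polynomial.monom (contract u \<phi> t) (w u))"
  have "poly p c = contract_form J w c \<phi> t" for c
    by (simp add: p_def contract_form_def poly_sum poly_monom mult.commute)
  then have "{c. contract_form J w c \<phi> = 0} \<subseteq> {c. poly p c = 0}" by auto
  then have "p = 0" using poly_roots_finite[of p] assms(3) finite_subset by blast
  have "0 = Polynomial.coeff p (w v)" using \<open>p = 0\<close> by simp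
  also have "\<dots> = (\<Sum>u\<in>J. if u = v then contract u \<phi> t else 0)"
    unfolding p_def coeff_sum using assms(2,4)
    by (intro sum.cong) (auto simp: inj_on_eq_iff)
  also have "\<dots> = contract v \<phi> t" using assms(1,4) by simp
  finally show "contract v \<phi> t = 0 t" by simp
qed

section \<open>Few functions of high degree\<close>

text \<open>This is the dual of the simplest case of Green's hyperplane restriction theorem: a quotient whose
  Hilbert function in degree \<open>d\<close> is at most \<open>d\<close> vanishes in degree \<open>d\<close> after division by a general linear
  form. Suppose infinitely many \<open>c\<close> are bad and let \<open>c\<^sub>0\<close> be a bad parameter whose kernel is as small
  as possible. The image of \<open>\<Psi>\<close> under the contraction at \<open>c\<^sub>0\<close> has degree \<open>d - 1\<close> and, since \<open>c\<^sub>0\<close> is bad,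
  dimension at most \<open>d - 1\<close>, so by induction almost all \<open>c\<close> act injectively on it. As contractions
  commute, the kernel at such a \<open>c\<close> lies in the kernel at \<open>c\<^sub>0\<close>, and it equals the latter by minimality
  if \<open>c\<close> is bad. So one nonzero function is killed by infinitely many linear forms of the curve,
  hence by every variable, which is impossible in positive degree.\<close>
lemma finite_noninjective_forms:
  fixes \<Psi> :: "(('v \<Rightarrow>\<^sub>0 nat) \<Rightarrow> 'k::field) set"
  assumes J: "finite J" "inj_on w J"
    and "funsp.subspace \<Psi>" "finite F" "\<Psi> \<subseteq> funsp.span F" "\<Psi> \<subseteq> homog J d" "funsp.dim \<Psi> \<le> d"
  shows "finite {c. \<exists>\<psi>\<in>\<Psi>. \<psi> \<noteq> 0 \<and> contract_form J w c \<psi> = 0}"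
  using assms(3-)
proof (induction d arbitrary: \<Psi> F)
  case 0
  have "\<Psi> \<subseteq> {0}"
  proof
    fix \<psi> assume psi: "\<psi> \<in> \<Psi>"
    show "\<psi> \<in> {0}"
    proof (rule ccontr)
      assume "\<psi> \<notin> {0}"
      then have "funsp.independent {\<psi>}" by simp
      then have "1 \<le> funsp.dim {\<psi>}" using funsp.dim_eq_card_independent[of "{\<psi>}"] by simp
      also have "\<dots> \<le> funsp.dim \<Psi>" using funsp.dim_subset_finite_span[OF 0(2,3)] psi by blast
      finally show False using 0 by simp
    qed
  qed
  then have "{c. \<exists>\<psi>\<in>\<Psi>. \<psi> \<noteq> 0 \<and> contract_form J w c \<psi> = 0} = {}" by blast
  then show ?case by (metis finite.emptyI)
next
  case (Suc d)
  define L :: "'k \<Rightarrow> (('v \<Rightarrow>\<^sub>0 nat) \<Rightarrow> 'k) \<Rightarrow> ('v \<Rightarrow>\<^sub>0 nat) \<Rightarrow> 'k" where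
    "L = contract_form J w"
  define Z where "Z c = {\<psi>\<in>\<Psi>. L c \<psi> = 0}" for c
  define B where "B = {c. \<exists>\<psi>\<in>\<Psi>. \<psi> \<noteq> 0 \<and> L c \<psi> = 0}"
  have lin: "Vector_Spaces.linear (\<lambda>c \<phi> t. c * \<phi> t) (\<lambda>c \<phi> t. c * \<phi> t) (L c)" for c
    unfolding L_def by (rule linear_contract_form)
  interpret vp: vector_space_pair "\<lambda>(c::'k) (\<phi>::('v \<Rightarrow>\<^sub>0 nat) \<Rightarrow> 'k) t. c * \<phi> t" "\<lambda>(c::'k) (\<phi>::('v \<Rightarrow>\<^sub>0 nat) \<Rightarrow> 'k) t. c * \<phi> t"
    by unfold_locales
  have subZ: "funsp.subspace (Z c)" for c
  proof -
    have "Z c = \<Psi> \<inter> {\<psi>. L c \<psi> = 0}" by (auto simp: Z_def)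
    then show ?thesis
      using vp.linear_subspace_kernel[OF lin, of c] funsp.subspace_inter[OF Suc.prems(1)] by simp
  qed
  have "finite B"
  proof (rule ccontr)
    assume inf: "infinite B"
    then obtain c0 where c0: "c0 \<in> B" and min: "\<And>c. c \<in> B \<Longrightarrow> funsp.dim (Z c0) \<le> funsp.dim (Z c)"
      using ex_has_least_nat[of "\<lambda>c. c \<in> B" _ "\<lambda>c. funsp.dim (Z c)"]
      by (metis finite.emptyI ex_in_conv)
    obtain \<psi> where psi: "\<psi> \<in> \<Psi>" "\<psi> \<noteq> 0" "L c0 \<psi> = 0" using c0 by (auto simp: B_def)
    have "funsp.dim (L c0 ` \<Psi>) < funsp.dim \<Psi>"
      by (rule funsp.dim_image_less_of_kernel[OF Suc.prems(2,3,1) lin psi])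
    then have dim: "funsp.dim (L c0 ` \<Psi>) \<le> d" using Suc.prems(5) by simp
    have fin: "finite {c. \<exists>\<psi>\<in>L c0 ` \<Psi>. \<psi> \<noteq> 0 \<and> contract_form J w c \<psi> = 0}"
    proof (rule Suc.IH[OF _ _ _ _ dim])
      show "funsp.subspace (L c0 ` \<Psi>)" by (rule vp.linear_subspace_image[OF lin Suc.prems(1)])
      show "finite (L c0 ` F)" using Suc.prems(2) by simp
      show "L c0 ` \<Psi> \<subseteq> funsp.span (L c0 ` F)"
        using vp.linear_span_image[OF lin, of c0 F] Suc.prems(3) by auto
      show "L c0 ` \<Psi> \<subseteq> homog J d"
        using Suc.prems(4) by (auto simp: L_def intro!: contract_form_homog[OF J(1)])
    qed
    \<comment> \<open>bad parameters that act injectively on the image: their kernels all coincide with the one at \<open>c0\<close>\<close>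
    define G where "G = B - {c. \<exists>\<psi>\<in>L c0 ` \<Psi>. \<psi> \<noteq> 0 \<and> contract_form J w c \<psi> = 0}"
    have infG: "infinite G" unfolding G_def using inf fin by simp
    have eqZ: "Z c = Z c0" if c: "c \<in> G" for c
    proof (rule funsp.subspace_eq_of_dim_ge[OF Suc.prems(2) _ subZ])
      show "Z c0 \<subseteq> funsp.span F" using Suc.prems(3) by (auto simp: Z_def)
      show "funsp.dim (Z c0) \<le> funsp.dim (Z c)" using min c by (auto simp: G_def)
      show "Z c \<subseteq> Z c0"
      proof
        fix \<phi> assume "\<phi> \<in> Z c"
        then have phi: "\<phi> \<in> \<Psi>" "L c \<phi> = 0" by (auto simp: Z_def)
        have "L c (L c0 \<phi>) = L c0 (L c \<phi>)" by (simp add: L_def contract_form_commute)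
        also have "\<dots> = 0" using phi(2) vp.linear_0[OF lin] by simp
        finally have "L c0 \<phi> = 0" using c phi(1) by (auto simp: G_def L_def)
        then show "\<phi> \<in> Z c0" using phi(1) by (simp add: Z_def)
      qed
    qed
    have "contract v \<psi> = 0" if "v \<in> J" for v
    proof (rule contractions_zero_if_forms_zero[OF J _ that])
      have "G \<subseteq> {c. contract_form J w c \<psi> = 0}"
        using eqZ psi by (auto simp: Z_def L_def)
      then show "infinite {c. contract_form J w c \<psi> = 0}" using infG finite_subset by blast
    qed
    then have "\<psi> = 0" using zero_if_contractions_zero Suc.prems(4) psi(1) by blast
    then show False using psi(2) by simp
  qed
  then show ?case unfolding B_def L_def .
qed

lemma sum_fun_apply: "(\<Sum>v\<in>J. f v) t = (\<Sum>v\<in>J. f v t)"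
  by (induction J rule: infinite_finite_induct) auto

lemma contract_form_in_subspace:
  assumes "funsp.subspace \<Phi>" "\<And>v. v \<in> J \<Longrightarrow> contract v \<phi> \<in> \<Phi>"
  shows "contract_form J w c \<phi> \<in> \<Phi>"
proof -
  have "contract_form J w c \<phi> = (\<Sum>v\<in>J. (\<lambda>t. c ^ w v * contract v \<phi> t))"
    by (simp add: fun_eq_iff sum_fun_apply contract_form_def)
  also have "\<dots> \<in> \<Phi>"
    by (intro funsp.subspace_sum[OF assms(1)] funsp.subspace_scale[OF assms(1)] assms(2))
  finally show ?thesis .
qed

section \<open>Persistence for inverse systems\<close>

text \<open>Compatibility makes the value at \<open>t\<close> independent of the variable that is split off from \<open>t\<close>:
  if \<open>t = r x\<^sub>u x\<^sub>v\<close>, both choices give the value at \<open>r\<close> of a twofold contraction. The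
  variable is therefore chosen arbitrarily.\<close>
lemma exists_common_lift:
  fixes \<psi> :: "'v \<Rightarrow> ('v \<Rightarrow>\<^sub>0 nat) \<Rightarrow> 'k::field"
  assumes "finite J" and hom: "\<And>v. v \<in> J \<Longrightarrow> \<psi> v \<in> homog J a"
    and comp: "\<And>u v. u \<in> J \<Longrightarrow> v \<in> J \<Longrightarrow> contract u (\<psi> v) = contract v (\<psi> u)"
  obtains \<chi> where "\<chi> \<in> homog J (Suc a)" "\<And>v. v \<in> J \<Longrightarrow> contract v \<chi> = \<psi> v"
proof -
  define pick where "pick t = (SOME v. v \<in> J \<and> Poly_Mapping.lookup t v \<noteq> 0)"
    for t :: "'v \<Rightarrow>\<^sub>0 nat"
  have pick: "pick t \<in> J \<and> Poly_Mapping.lookup t (pick t) \<noteq> 0" if "deg_in J t = Suc a" for t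
    unfolding pick_def by (rule someI_ex) (use deg_in_pos_factor[OF that] in blast)
  define \<chi> where "\<chi> t = (if deg_in J t = Suc a
      then \<psi> (pick t) (t - Poly_Mapping.single (pick t) 1) else 0)" for t
  have "\<chi> \<in> homog J (Suc a)" by (auto simp: homog_def \<chi>_def)
  moreover have "contract v \<chi> = \<psi> v" if v: "v \<in> J" for v
  proof
    fix t :: "'v \<Rightarrow>\<^sub>0 nat"
    let ?T = "t + Poly_Mapping.single v 1"
    have degT: "deg_in J ?T = Suc (deg_in J t)" using deg_in_single[OF assms(1) v]
      by (simp add: deg_in_add)
    show "contract v \<chi> t = \<psi> v t"
    proof (cases "deg_in J t = a")
      case False
      then have "\<psi> v t = 0" using hom[OF v] by (auto simp: homog_def)
      then show ?thesis using False degT by (simp add: contract_def \<chi>_def)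
    next
      case True
      define u where "u = pick ?T"
      have u: "u \<in> J" "Poly_Mapping.lookup ?T u \<noteq> 0" using pick[of ?T] degT True by (auto simp: u_def)
      have "contract v \<chi> t = \<psi> u (?T - Poly_Mapping.single u 1)"
        using degT True by (simp add: contract_def \<chi>_def u_def)
      also have "\<dots> = \<psi> v t"
      proof (cases "u = v")
        case False
        define r where "r = t - Poly_Mapping.single u 1"
        have t: "r + Poly_Mapping.single u 1 = t"
          unfolding r_def using u(2) False
          by (intro monomial_factor) (simp add: lookup_add lookup_single)
        have "?T - Poly_Mapping.single u 1 = r + Poly_Mapping.single v 1"
          unfolding t[symmetric] by (metis add.assoc add.commute add_diff_cancel_right')
        then have "\<psi> u (?T - Poly_Mapping.single u 1) = contract v (\<psi> u) r"
          by (simp add: contract_def)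
        also have "\<dots> = contract u (\<psi> v) r" using comp u(1) v by metis
        also have "\<dots> = \<psi> v t" unfolding contract_def t ..
        finally show ?thesis .
      qed simp
      finally show ?thesis .
    qed
  qed
  ultimately show ?thesis using that by blast
qed

text \<open>A linear form \<open>L\<close> that is injective on degree \<open>d\<close> exists because the dimension there is at most \<open>d\<close>,
  and injectivity passes to all higher degrees by contracting with the variables. Equality of the
  dimensions in degrees \<open>d\<close> and \<open>d + 1\<close> makes \<open>L\<close> bijective between them. Surjectivity propagates: to
  lift \<open>\<phi>\<close> through \<open>L\<close>, lift its contractions by the variables, one degree lower; the lifts are
  compatible because \<open>L\<close> is injective, so they are the contractions of a single function, which belongs
  to the system by the hypothesis \<open>glue\<close>. Thus \<open>L\<close> is bijective in all degrees from \<open>d\<close> on.\<close>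
lemma inverse_system_persistence:
  fixes \<Phi> :: "nat \<Rightarrow> (('v \<Rightarrow>\<^sub>0 nat) \<Rightarrow> 'k::field) set"
  assumes inf: "infinite (UNIV :: 'k set)" and J: "finite J"
    and sub: "\<And>a. funsp.subspace (\<Phi> a)"
    and fin: "\<And>a. \<exists>F. finite F \<and> \<Phi> a \<subseteq> funsp.span F"
    and hom: "\<And>a. \<Phi> a \<subseteq> homog J a"
    and contr: "\<And>a v \<phi>. \<phi> \<in> \<Phi> (Suc a) \<Longrightarrow> v \<in> J \<Longrightarrow> contract v \<phi> \<in> \<Phi> a"
    and glue: "\<And>a \<psi>. d \<le> a \<Longrightarrow> \<psi> \<in> homog J (Suc a) \<Longrightarrow> (\<And>v. v \<in> J \<Longrightarrow> contract v \<psi> \<in> \<Phi> a)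
      \<Longrightarrow> \<psi> \<in> \<Phi> (Suc a)"
    and dim: "funsp.dim (\<Phi> d) = m" "funsp.dim (\<Phi> (Suc d)) = m" and "m \<le> d" and "d \<le> a"
  shows "funsp.dim (\<Phi> a) = m"
proof -
  obtain w :: "'v \<Rightarrow> nat" where w: "inj_on w J"
    using finite_imp_inj_to_nat_seg[OF J] by blast
  obtain F where F: "finite F" "\<Phi> d \<subseteq> funsp.span F" using fin by blast
  have "finite {c. \<exists>\<psi>\<in>\<Phi> d. \<psi> \<noteq> 0 \<and> contract_form J w c \<psi> = 0}"
    using finite_noninjective_forms[OF J w sub F hom] dim(1) \<open>m \<le> d\<close> by simp
  then obtain c where "c \<notin> {c. \<exists>\<psi>\<in>\<Phi> d. \<psi> \<noteq> 0 \<and> contract_form J w c \<psi> = 0}"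
    using ex_new_if_finite[OF inf] by blast
  then have c: "\<And>\<psi>. \<psi> \<in> \<Phi> d \<Longrightarrow> contract_form J w c \<psi> = 0 \<Longrightarrow> \<psi> = 0" by blast
  define L :: "(('v \<Rightarrow>\<^sub>0 nat) \<Rightarrow> 'k) \<Rightarrow> ('v \<Rightarrow>\<^sub>0 nat) \<Rightarrow> 'k" where "L = contract_form J w c"
  interpret vp: vector_space_pair "\<lambda>(c::'k) (\<phi>::('v \<Rightarrow>\<^sub>0 nat) \<Rightarrow> 'k) t. c * \<phi> t" "\<lambda>(c::'k) (\<phi>::('v \<Rightarrow>\<^sub>0 nat) \<Rightarrow> 'k) t. c * \<phi> t"
    by unfold_locales
  have lin: "Vector_Spaces.linear (\<lambda>c \<phi> t. c * \<phi> t) (\<lambda>c \<phi> t. c * \<phi> t) L"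
    unfolding L_def by (rule linear_contract_form)
  have Lv: "contract v (L \<phi>) = L (contract v \<phi>)" for v \<phi>
    unfolding L_def by (rule contract_contract_form)
  have c0: "contract v 0 = (0 :: ('v \<Rightarrow>\<^sub>0 nat) \<Rightarrow> 'k)" for v :: 'v by (simp add: contract_def fun_eq_iff)
  have Lmap: "L \<phi> \<in> \<Phi> b" if "\<phi> \<in> \<Phi> (Suc b)" for \<phi> b
    unfolding L_def using contract_form_in_subspace[OF sub] contr[OF that] by blast
  have inj: "\<psi> = 0" if "d \<le> b" "\<psi> \<in> \<Phi> b" "L \<psi> = 0" for b \<psi>
    using that
  proof (induction b arbitrary: \<psi> rule: dec_induct)
    case base
    then show ?case using c unfolding L_def by blast
  next
    case (step b)
    have "contract v \<psi> = 0" if "v \<in> J" for v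
      using step.IH[OF contr[OF step.prems(1) that]] Lv[of v \<psi>] c0 step.prems(2) by metis
    then show ?case using zero_if_contractions_zero hom step.prems(1) by blast
  qed
  have inj_eq: "\<phi> = \<psi>" if "d \<le> b" "\<phi> \<in> \<Phi> b" "\<psi> \<in> \<Phi> b" "L \<phi> = L \<psi>" for b \<phi> \<psi>
    using inj[OF that(1) funsp.subspace_diff[OF sub that(2,3)]] that(4)
      vp.linear_diff[OF lin, of \<phi> \<psi>] by simp
  have dimL: "funsp.dim (L ` \<Phi> b) = funsp.dim (\<Phi> b)" if "d \<le> b" for b
  proof -
    obtain F where F: "finite F" "\<Phi> b \<subseteq> funsp.span F" using fin by blast
    show ?thesis using funsp.dim_image_of_inj[OF F sub lin] inj[OF that] by blast
  qed
  have surj: "L ` \<Phi> (Suc b) = \<Phi> b" if "d \<le> b" for b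
    using that
  proof (induction b rule: dec_induct)
    case base
    show ?case
    proof (rule funsp.subspace_eq_of_dim_ge[OF F])
      show "funsp.subspace (L ` \<Phi> (Suc d))" by (rule vp.linear_subspace_image[OF lin sub])
      show "L ` \<Phi> (Suc d) \<subseteq> \<Phi> d" using Lmap by blast
      show "funsp.dim (\<Phi> d) \<le> funsp.dim (L ` \<Phi> (Suc d))" using dimL[of "Suc d"] dim by simp
    qed
  next
    case (step b)
    show ?case
    proof
      show "L ` \<Phi> (Suc (Suc b)) \<subseteq> \<Phi> (Suc b)" using Lmap by blast
      show "\<Phi> (Suc b) \<subseteq> L ` \<Phi> (Suc (Suc b))"
      proof
        fix \<phi> assume phi: "\<phi> \<in> \<Phi> (Suc b)"
        have "\<exists>\<psi>\<in>\<Phi> (Suc b). L \<psi> = contract v \<phi>" if "v \<in> J" for v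
          using contr[OF phi that] step.IH by (metis imageE)
        then obtain \<psi> where psi: "\<And>v. v \<in> J \<Longrightarrow> \<psi> v \<in> \<Phi> (Suc b)"
            "\<And>v. v \<in> J \<Longrightarrow> L (\<psi> v) = contract v \<phi>"
          by metis
        have comp: "contract u (\<psi> v) = contract v (\<psi> u)" if "u \<in> J" "v \<in> J" for u v
        proof (rule inj_eq[OF step.hyps(1)])
          show "contract u (\<psi> v) \<in> \<Phi> b" "contract v (\<psi> u) \<in> \<Phi> b" using contr psi(1) that by auto
          show "L (contract u (\<psi> v)) = L (contract v (\<psi> u))"
            using psi(2) that by (simp flip: Lv add: contract_commute)
        qed
        obtain \<chi> where chi: "\<chi> \<in> homog J (Suc (Suc b))" "\<And>v. v \<in> J \<Longrightarrow> contract v \<chi> = \<psi> v"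
          using exists_common_lift[of J \<psi> "Suc b"] J psi(1) hom comp by blast
        have mem: "\<chi> \<in> \<Phi> (Suc (Suc b))" using glue[of "Suc b" \<chi>] step.hyps chi psi(1) by simp
        have "L \<chi> - \<phi> = 0"
        proof (rule zero_if_contractions_zero)
          show "L \<chi> - \<phi> \<in> homog J (Suc b)"
            using hom funsp.subspace_diff[OF sub Lmap[OF mem] phi] by blast
          show "contract v (L \<chi> - \<phi>) = 0" if "v \<in> J" for v
            using Lv[of v \<chi>] chi(2)[OF that] psi(2)[OF that] vp.linear_diff[OF linear_contract]
            by simp
        qed
        then show "\<phi> \<in> L ` \<Phi> (Suc (Suc b))" using mem by (metis eq_iff_diff_eq_0 imageI)
      qed
    qed
  qed
  show ?thesis using \<open>d \<le> a\<close>
  proof (induction a rule: dec_induct)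
    case base
    then show ?case by (rule dim(1))
  next
    case (step b)
    then show ?case using dimL[of "Suc b"] surj[of b] by simp
  qed
qed

section \<open>Graded pieces of the quotient ring as vector spaces\<close>

lemma poly_mapping_expand: "p = (\<Sum>t\<in>Poly_Mapping.keys p. Poly_Mapping.single t (Poly_Mapping.lookup p t))"
  by (intro poly_mapping_eqI) (auto simp: lookup_sum lookup_single when_def in_keys_iff)

lemma keys_sum_subset:
  assumes "\<And>i. i \<in> A \<Longrightarrow> Poly_Mapping.keys (f i) \<subseteq> K"
  shows "Poly_Mapping.keys (\<Sum>i\<in>A. f i) \<subseteq> K"
  using assms
proof (induction A rule: infinite_finite_induct)
  case (insert x F)
  have "Poly_Mapping.keys (\<Sum>i\<in>insert x F. f i) \<subseteq> Poly_Mapping.keys (f x) \<union> Poly_Mapping.keys (\<Sum>i\<in>F. f i)"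
    using keys_add[of "f x" "sum f F"] insert.hyps by simp
  moreover have "Poly_Mapping.keys (f x) \<subseteq> K" using insert.prems by simp
  moreover have "Poly_Mapping.keys (\<Sum>i\<in>F. f i) \<subseteq> K" using insert.IH insert.prems by simp
  ultimately show ?case by blast
qed auto

lemma keys_scalar_mult: "Poly_Mapping.keys (Poly_Mapping.single 0 c * p) \<subseteq> Poly_Mapping.keys p"
  for p :: "('a::cancel_comm_monoid_add) \<Rightarrow>\<^sub>0 'k::field"
  using keys_mult[of "Poly_Mapping.single 0 c" p] by (auto split: if_splits)

lemma keys_monomial_add:
  "Poly_Mapping.keys (s + t) = Poly_Mapping.keys s \<union> Poly_Mapping.keys t"
  for s t :: "'v \<Rightarrow>\<^sub>0 nat"
  by (auto simp: in_keys_iff lookup_add)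

lemma cox_ring_simps [simp]:
  "mult (cox_ring s n) = (*)" "add (cox_ring s n) = (+)"
  "one (cox_ring s n) = 1" "zero (cox_ring s n) = 0"
  by (simp_all add: cox_ring_def)

lemma cox_carrier_iff:
  "p \<in> carrier (cox_ring s n) \<longleftrightarrow> (\<forall>t\<in>Poly_Mapping.keys p. Poly_Mapping.keys t \<subseteq> cox_vars s n)"
  by (simp add: cox_ring_def)

lemma cox_carrier_closed:
  "0 \<in> carrier (cox_ring s n)" "1 \<in> carrier (cox_ring s n)"
  "p \<in> carrier (cox_ring s n) \<Longrightarrow> q \<in> carrier (cox_ring s n) \<Longrightarrow> p + q \<in> carrier (cox_ring s n)"
  "p \<in> carrier (cox_ring s n) \<Longrightarrow> q \<in> carrier (cox_ring s n) \<Longrightarrow> p - q \<in> carrier (cox_ring s n)"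
  "p \<in> carrier (cox_ring s n) \<Longrightarrow> q \<in> carrier (cox_ring s n) \<Longrightarrow> p * q \<in> carrier (cox_ring s n)"
  "p \<in> carrier (cox_ring s n) \<Longrightarrow> - p \<in> carrier (cox_ring s n)"
  "Poly_Mapping.keys t \<subseteq> cox_vars s n \<Longrightarrow> Poly_Mapping.single t c \<in> carrier (cox_ring s n)"
proof -
  show "0 \<in> carrier (cox_ring s n)" "1 \<in> carrier (cox_ring s n)"
    by (auto simp: cox_carrier_iff)
  show "Poly_Mapping.keys t \<subseteq> cox_vars s n \<Longrightarrow> Poly_Mapping.single t c \<in> carrier (cox_ring s n)"
    by (auto simp: cox_carrier_iff)
  assume p: "p \<in> carrier (cox_ring s n)"
  show "- p \<in> carrier (cox_ring s n)" using p by (auto simp: cox_carrier_iff in_keys_iff)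
  assume q: "q \<in> carrier (cox_ring s n)"
  show "p + q \<in> carrier (cox_ring s n)"
    using p q keys_add[of p q] by (fastforce simp: cox_carrier_iff)
  show "p - q \<in> carrier (cox_ring s n)"
    using p q keys_diff[of p q] unfolding cox_carrier_iff by blast
  show "p * q \<in> carrier (cox_ring s n)"
    unfolding cox_carrier_iff
  proof
    fix t assume "t \<in> Poly_Mapping.keys (p * q)"
    then obtain a b where "t = a + b" "a \<in> Poly_Mapping.keys p" "b \<in> Poly_Mapping.keys q"
      using keys_mult[of p q] by auto
    then show "Poly_Mapping.keys t \<subseteq> cox_vars s n"
      using p q by (simp add: cox_carrier_iff keys_monomial_add)
  qed
qed

lemma cox_ring_cring: "cring (cox_ring s n :: ('k::field) cox_poly ring)"
proof (rule cringI)
  show "abelian_group (cox_ring s n :: 'k cox_poly ring)"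
  proof (rule abelian_groupI)
    fix p :: "'k cox_poly" assume "p \<in> carrier (cox_ring s n)"
    then show "\<exists>q\<in>carrier (cox_ring s n). q \<oplus>\<^bsub>cox_ring s n\<^esub> p = \<zero>\<^bsub>cox_ring s n\<^esub>"
      by (intro bexI[of _ "- p"]) (simp_all add: cox_carrier_closed)
  qed (simp_all add: cox_carrier_closed add.assoc add.commute)
  show "Group.comm_monoid (cox_ring s n :: 'k cox_poly ring)"
    by (rule comm_monoidI) (simp_all add: cox_carrier_closed mult.assoc mult.commute)
qed (simp add: distrib_right)

locale cox_ideal = ideal I "cox_ring s n" for s n and I :: "('k::field) cox_poly set"
begin

lemma mem_carrier: "f \<in> I \<Longrightarrow> f \<in> carrier (cox_ring s n)"
  using a_subset by blast

lemma zero_mem: "0 \<in> I"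
  using additive_subgroup.zero_closed[OF is_additive_subgroup] by simp

lemma add_mem: "f \<in> I \<Longrightarrow> g \<in> I \<Longrightarrow> f + g \<in> I"
  using additive_subgroup.a_closed[OF is_additive_subgroup] by simp

lemma mult_mem: "p \<in> carrier (cox_ring s n) \<Longrightarrow> f \<in> I \<Longrightarrow> p * f \<in> I"
  using I_l_closed by simp

lemma scalar_mem: "f \<in> I \<Longrightarrow> Poly_Mapping.single 0 c * f \<in> I"
  by (rule mult_mem) (auto intro: cox_carrier_closed)

lemma uminus_mem: "f \<in> I \<Longrightarrow> - f \<in> I"
  using mult_mem[of "- 1" f] by (simp add: cox_carrier_closed)

lemma minus_mem: "f \<in> I \<Longrightarrow> g \<in> I \<Longrightarrow> f - g \<in> I"
  using add_mem[of f "- g"] uminus_mem by simp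

lemma sum_mem: "(\<And>i. i \<in> A \<Longrightarrow> f i \<in> I) \<Longrightarrow> (\<Sum>i\<in>A. f i) \<in> I"
  by (induction A rule: infinite_finite_induct) (auto intro: zero_mem add_mem)

abbreviation coset :: "'k cox_poly \<Rightarrow> 'k cox_poly set" where
  "coset p \<equiv> I +>\<^bsub>cox_ring s n\<^esub> p"

lemma coset_add:
  "p \<in> carrier (cox_ring s n) \<Longrightarrow> q \<in> carrier (cox_ring s n) \<Longrightarrow>
    coset p \<oplus>\<^bsub>cox_ring s n Quot I\<^esub> coset q = coset (p + q)"
  using ring_hom_add[OF rcos_ring_hom, of p q] by simp

lemma coset_mult:
  "p \<in> carrier (cox_ring s n) \<Longrightarrow> q \<in> carrier (cox_ring s n) \<Longrightarrow>
    coset p \<otimes>\<^bsub>cox_ring s n Quot I\<^esub> coset q = coset (p * q)"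
  using ring_hom_mult[OF rcos_ring_hom, of p q] by simp

lemma coset_zero: "coset 0 = \<zero>\<^bsub>cox_ring s n Quot I\<^esub>"
  using a_rcos_zero[OF is_ideal zero_mem] by (simp add: FactRing_def)

lemma coset_eq_zero_iff:
  "p \<in> carrier (cox_ring s n) \<Longrightarrow> coset p = \<zero>\<^bsub>cox_ring s n Quot I\<^esub> \<longleftrightarrow> p \<in> I"
  using a_rcos_zero[OF is_ideal] rcos_const_imp_mem by (auto simp: FactRing_def)

lemma coset_eq_of_minus_mem:
  assumes "p \<in> carrier (cox_ring s n)" "q \<in> carrier (cox_ring s n)" "p - q \<in> I"
  shows "coset p = coset q"
proof -
  have "coset (p - q) \<oplus>\<^bsub>cox_ring s n Quot I\<^esub> coset q = coset p"
    using coset_add[of "p - q" q] assms mem_carrier by simp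
  moreover have "coset (p - q) = coset 0"
    using assms coset_eq_zero_iff mem_carrier coset_zero by simp
  ultimately show ?thesis using coset_add[of 0 q] assms(2) by (simp add: cox_carrier_closed)
qed

lemma coset_eq_imp_minus_mem:
  assumes "p \<in> carrier (cox_ring s n)" "q \<in> carrier (cox_ring s n)" "coset p = coset q"
  shows "p - q \<in> I"
proof -
  have "coset (p - q) = coset p \<oplus>\<^bsub>cox_ring s n Quot I\<^esub> coset (- q)"
    using coset_add[of p "- q"] assms by (simp add: cox_carrier_closed)
  also have "\<dots> = coset 0" using coset_add[of q "- q"] assms by (simp add: cox_carrier_closed)
  finally show ?thesis using coset_eq_zero_iff[of "p - q"] coset_zero assms
    by (simp add: cox_carrier_closed)
qed

lemma quot_piece_simps:
  "carrier (quot_piece s n I a) = coset ` cox_piece s n a"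
  "add (quot_piece s n I a) = add (cox_ring s n Quot I)"
  "zero (quot_piece s n I a) = zero (cox_ring s n Quot I)"
  "smult (quot_piece s n I a) = (\<lambda>c X. coset (Poly_Mapping.single 0 c) \<otimes>\<^bsub>cox_ring s n Quot I\<^esub> X)"
  by (simp_all add: quot_piece_def Let_def)

end

lemma cox_piece_closed:
  "0 \<in> cox_piece s n a"
  "p \<in> cox_piece s n a \<Longrightarrow> q \<in> cox_piece s n a \<Longrightarrow> p + q \<in> cox_piece s n a"
  "p \<in> cox_piece s n a \<Longrightarrow> Poly_Mapping.single 0 c * p \<in> cox_piece s n a"
  "p \<in> cox_piece s n a \<Longrightarrow> - p \<in> cox_piece s n a"
  "p \<in> cox_piece s n a \<Longrightarrow> p \<in> carrier (cox_ring s n)"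
proof -
  show "0 \<in> cox_piece s n a" by (auto simp: cox_piece_def cox_carrier_closed)
  assume p: "p \<in> cox_piece s n a"
  then show "p \<in> carrier (cox_ring s n)" by (simp add: cox_piece_def)
  show "- p \<in> cox_piece s n a" using p by (auto simp: cox_piece_def cox_carrier_closed in_keys_iff)
  show "Poly_Mapping.single 0 c * p \<in> cox_piece s n a"
    using p keys_scalar_mult[of c p] by (auto simp: cox_piece_def cox_carrier_closed)
  assume q: "q \<in> cox_piece s n a"
  show "p + q \<in> cox_piece s n a"
    using p q keys_add[of p q] by (fastforce simp: cox_piece_def cox_carrier_closed)
qed

context cox_ideal
begin

lemma smult_coset:
  assumes "p \<in> carrier (cox_ring s n)"
  shows "c \<odot>\<^bsub>quot_piece s n I a\<^esub> coset p = coset (Poly_Mapping.single 0 c * p)"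
  using assms coset_mult[of "Poly_Mapping.single 0 c" p]
  by (simp add: quot_piece_simps cox_carrier_closed)

lemma quot_piece_vectorspace: "vectorspace (class_ring :: 'k ring) (quot_piece s n I a)"
proof (rule vs_criteria, unfold quot_piece_simps(1))
  note simps = quot_piece_simps(2,3) smult_coset coset_add cox_carrier_closed
    cox_piece_closed(5) coset_zero[symmetric]
  show "field (class_ring :: 'k ring)" by (rule class_field)
  show "\<zero>\<^bsub>quot_piece s n I a\<^esub> \<in> coset ` cox_piece s n a"
    using cox_piece_closed(1) by (auto simp: simps)
  show "\<forall>v w. v \<in> coset ` cox_piece s n a \<and> w \<in> coset ` cox_piece s n a \<longrightarrow>
      v \<oplus>\<^bsub>quot_piece s n I a\<^esub> w \<in> coset ` cox_piece s n a"
    by (auto simp: simps intro!: imageI cox_piece_closed(2))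
  show "\<forall>v\<in>coset ` cox_piece s n a. \<exists>w\<in>coset ` cox_piece s n a.
      v \<oplus>\<^bsub>quot_piece s n I a\<^esub> w = \<zero>\<^bsub>quot_piece s n I a\<^esub>"
  proof
    fix v assume "v \<in> coset ` cox_piece s n a"
    then obtain p where "p \<in> cox_piece s n a" "v = coset p" by auto
    then show "\<exists>w\<in>coset ` cox_piece s n a. v \<oplus>\<^bsub>quot_piece s n I a\<^esub> w = \<zero>\<^bsub>quot_piece s n I a\<^esub>"
      using cox_piece_closed(4)[of p s n a] by (auto simp: simps intro!: bexI[of _ "- p"])
  qed
  show "\<forall>c v. c \<in> carrier class_ring \<and> v \<in> coset ` cox_piece s n a \<longrightarrow>
      c \<odot>\<^bsub>quot_piece s n I a\<^esub> v \<in> coset ` cox_piece s n a"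
    by (auto simp: simps intro!: imageI cox_piece_closed(3))
  show "\<forall>v w. v \<in> coset ` cox_piece s n a \<and> w \<in> coset ` cox_piece s n a \<longrightarrow>
      v \<oplus>\<^bsub>quot_piece s n I a\<^esub> w = w \<oplus>\<^bsub>quot_piece s n I a\<^esub> v"
    by (auto simp: simps add.commute)
  show "\<forall>v w x. v \<in> coset ` cox_piece s n a \<and> w \<in> coset ` cox_piece s n a \<and> x \<in> coset ` cox_piece s n a \<longrightarrow>
      v \<oplus>\<^bsub>quot_piece s n I a\<^esub> w \<oplus>\<^bsub>quot_piece s n I a\<^esub> x =
      v \<oplus>\<^bsub>quot_piece s n I a\<^esub> (w \<oplus>\<^bsub>quot_piece s n I a\<^esub> x)"
    by (auto simp: simps add.assoc)
  show "\<forall>v\<in>coset ` cox_piece s n a. v \<oplus>\<^bsub>quot_piece s n I a\<^esub> \<zero>\<^bsub>quot_piece s n I a\<^esub> = v"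
    by (auto simp: simps)
  show "\<forall>c b v. c \<in> carrier class_ring \<and> b \<in> carrier class_ring \<and> v \<in> coset ` cox_piece s n a \<longrightarrow>
      (c \<otimes>\<^bsub>class_ring\<^esub> b) \<odot>\<^bsub>quot_piece s n I a\<^esub> v = c \<odot>\<^bsub>quot_piece s n I a\<^esub> (b \<odot>\<^bsub>quot_piece s n I a\<^esub> v)"
    by (auto simp: simps mult_single simp flip: mult.assoc)
  show "\<forall>v\<in>coset ` cox_piece s n a. \<one>\<^bsub>class_ring\<^esub> \<odot>\<^bsub>quot_piece s n I a\<^esub> v = v"
    by (auto simp: simps)
  show "\<forall>c b v. c \<in> carrier class_ring \<and> b \<in> carrier class_ring \<and> v \<in> coset ` cox_piece s n a \<longrightarrow>
      (c \<oplus>\<^bsub>class_ring\<^esub> b) \<odot>\<^bsub>quot_piece s n I a\<^esub> v =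
      (c \<odot>\<^bsub>quot_piece s n I a\<^esub> v) \<oplus>\<^bsub>quot_piece s n I a\<^esub> (b \<odot>\<^bsub>quot_piece s n I a\<^esub> v)"
    by (auto simp: simps single_add distrib_right)
  show "\<forall>c v w. c \<in> carrier class_ring \<and> v \<in> coset ` cox_piece s n a \<and> w \<in> coset ` cox_piece s n a \<longrightarrow>
      c \<odot>\<^bsub>quot_piece s n I a\<^esub> (v \<oplus>\<^bsub>quot_piece s n I a\<^esub> w) =
      (c \<odot>\<^bsub>quot_piece s n I a\<^esub> v) \<oplus>\<^bsub>quot_piece s n I a\<^esub> (c \<odot>\<^bsub>quot_piece s n I a\<^esub> w)"
    by (auto simp: simps distrib_left)
qed

end

definition piece_monomials :: "nat \<Rightarrow> (nat \<Rightarrow> nat) \<Rightarrow> (nat \<Rightarrow> nat) \<Rightarrow> monomial set" where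
  "piece_monomials s n u = {t. Poly_Mapping.keys t \<subseteq> cox_vars s n \<and> (\<forall>i\<in>{1..s}. multideg t i = int (u i))}"

lemma cox_piece_iff: "p \<in> cox_piece s n (\<lambda>i. int (u i)) \<longleftrightarrow> Poly_Mapping.keys p \<subseteq> piece_monomials s n u"
  by (auto simp: cox_piece_def piece_monomials_def cox_carrier_iff)

text \<open>The Hilbert function counts standard monomials: the hypotheses say that the classes of the monomials
  in \<open>T\<close> are linearly independent modulo \<open>I\<close> and that they span.\<close>
lemma (in cox_ideal) hilbert_fun_eq_card:
  assumes fin: "finite T" and sub: "T \<subseteq> piece_monomials s n u"
    and indep: "\<And>f. f \<in> I \<Longrightarrow> Poly_Mapping.keys f \<subseteq> T \<Longrightarrow> f = 0"
    and gen: "\<And>t. t \<in> piece_monomials s n u \<Longrightarrow> \<exists>r. Poly_Mapping.keys r \<subseteq> T \<and> Poly_Mapping.single t 1 - r \<in> I"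
  shows "hilbert_fun s n I u = card T"
proof -
  define V where "V = quot_piece s n I (\<lambda>i. int (u i))"
  interpret V: vectorspace "class_ring :: 'k ring" V
    unfolding V_def by (rule quot_piece_vectorspace)
  define e where "e t = coset (Poly_Mapping.single t 1)" for t
  have mon: "Poly_Mapping.single t c \<in> carrier (cox_ring s n)" if "t \<in> T" for t and c :: 'k
    using that sub by (auto simp: piece_monomials_def intro: cox_carrier_closed)
  have car: "p \<in> carrier (cox_ring s n)" if "Poly_Mapping.keys p \<subseteq> T" for p :: "'k cox_poly"
    using that sub by (auto simp: piece_monomials_def cox_carrier_iff)
  have eV: "e t \<in> carrier V" if "t \<in> T" for t
    using that sub unfolding e_def V_def quot_piece_simps
    by (intro imageI) (auto simp: cox_piece_iff)
  have inj: "inj_on e T"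
  proof
    fix t t' assume t: "t \<in> T" "t' \<in> T" "e t = e t'"
    have "Poly_Mapping.single t 1 - Poly_Mapping.single t' (1 :: 'k) = 0"
    proof (rule indep)
      show "Poly_Mapping.single t 1 - Poly_Mapping.single t' 1 \<in> I"
        using t mon by (intro coset_eq_imp_minus_mem) (auto simp: e_def)
      show "Poly_Mapping.keys (Poly_Mapping.single t 1 - Poly_Mapping.single t' (1 :: 'k)) \<subseteq> T"
        using t by (auto simp: in_keys_iff lookup_minus lookup_single when_def split: if_splits)
    qed
    then have "Poly_Mapping.single t (1 :: 'k) = Poly_Mapping.single t' 1" by simp
    then have "Poly_Mapping.keys (Poly_Mapping.single t (1 :: 'k)) = Poly_Mapping.keys (Poly_Mapping.single t' (1::'k))"
      by simp
    then show "t = t'" by simp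
  qed
  have smul: "c \<odot>\<^bsub>V\<^esub> e t = coset (Poly_Mapping.single t c)" if "t \<in> T" for c t
    using mon[OF that] by (simp add: V_def e_def smult_coset mult_single)
  have comb: "V.lincomb a (e ` T) = coset (\<Sum>t\<in>T. Poly_Mapping.single t (a (e t)))" for a
  proof -
    have "V.lincomb a (e ` T) = finsum V (\<lambda>t. a (e t) \<odot>\<^bsub>V\<^esub> e t) T"
      unfolding V.lincomb_def using inj eV
      by (subst V.M.finsum_reindex) (auto intro!: V.smult_closed)
    also have "finsum V (\<lambda>t. a (e t) \<odot>\<^bsub>V\<^esub> e t) T' = coset (\<Sum>t\<in>T'. Poly_Mapping.single t (a (e t)))"
      if "T' \<subseteq> T" for T'
      using finite_subset[OF that fin] that
    proof (induction T' rule: finite_induct)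
      case empty
      have "\<zero>\<^bsub>V\<^esub> = coset 0" by (simp add: V_def quot_piece_simps(3) coset_zero)
      then show ?case by (simp only: V.M.finsum_empty sum.empty)
    next
      case (insert t F)
      have keys: "Poly_Mapping.keys (\<Sum>t\<in>F. Poly_Mapping.single t (a (e t))) \<subseteq> T"
        using insert.prems by (intro keys_sum_subset) (auto split: if_splits)
      have "finsum V (\<lambda>t. a (e t) \<odot>\<^bsub>V\<^esub> e t) (insert t F) =
          a (e t) \<odot>\<^bsub>V\<^esub> e t \<oplus>\<^bsub>V\<^esub> finsum V (\<lambda>t. a (e t) \<odot>\<^bsub>V\<^esub> e t) F"
        using insert.hyps insert.prems eV
        by (subst V.M.finsum_insert) (auto intro!: V.smult_closed)
      also have "\<dots> = coset (Poly_Mapping.single t (a (e t)) + (\<Sum>t\<in>F. Poly_Mapping.single t (a (e t))))"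
        using insert.IH insert.prems smul mon coset_add car[OF keys]
        by (simp add: V_def quot_piece_simps(2))
      finally show ?case using insert.hyps by simp
    qed
    finally show ?thesis by simp
  qed
  have "V.basis (e ` T)"
    unfolding V.basis_def
  proof (intro conjI)
    show car_e: "e ` T \<subseteq> carrier V" using eV by blast
    show "V.lin_indpt (e ` T)"
    proof (rule V.finite_lin_indpt2)
      fix a assume "V.lincomb a (e ` T) = \<zero>\<^bsub>V\<^esub>"
      let ?f = "\<Sum>t\<in>T. Poly_Mapping.single t (a (e t))"
      have keys: "Poly_Mapping.keys ?f \<subseteq> T" by (intro keys_sum_subset) (auto split: if_splits)
      have "coset ?f = \<zero>\<^bsub>cox_ring s n Quot I\<^esub>"
        using \<open>V.lincomb a (e ` T) = \<zero>\<^bsub>V\<^esub>\<close> comb by (simp add: V_def quot_piece_simps(3))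
      then have "?f = 0" using coset_eq_zero_iff[OF car[OF keys]] indep keys by blast
      have "a (e t) = 0" if "t \<in> T" for t
      proof -
        have "0 = Poly_Mapping.lookup ?f t" using \<open>?f = 0\<close> by simp
        also have "\<dots> = a (e t)" using that fin by (simp add: lookup_sum lookup_single when_def)
        finally show ?thesis by simp
      qed
      then show "\<forall>v\<in>e ` T. a v = \<zero>\<^bsub>class_ring\<^esub>" by simp
    qed (use fin car_e in auto)
    show "V.gen_set (e ` T)"
    proof
      show "V.span (e ` T) \<subseteq> carrier V" using car_e by (rule V.span_is_subset2)
      show "carrier V \<subseteq> V.span (e ` T)"
      proof
        fix X assume "X \<in> carrier V"
        then obtain p where p: "Poly_Mapping.keys p \<subseteq> piece_monomials s n u" "X = coset p"
          by (auto simp: V_def quot_piece_simps cox_piece_iff)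
        obtain r where r: "\<And>t. t \<in> piece_monomials s n u \<Longrightarrow> Poly_Mapping.keys (r t) \<subseteq> T"
            "\<And>t. t \<in> piece_monomials s n u \<Longrightarrow> Poly_Mapping.single t 1 - r t \<in> I"
          using gen by metis
        define g where "g = (\<Sum>t\<in>Poly_Mapping.keys p. Poly_Mapping.single 0 (Poly_Mapping.lookup p t) * r t)"
        have keys: "Poly_Mapping.keys g \<subseteq> T"
          unfolding g_def using r(1) p(1) keys_scalar_mult by (intro keys_sum_subset) blast
        have "p - g = (\<Sum>t\<in>Poly_Mapping.keys p.
            Poly_Mapping.single 0 (Poly_Mapping.lookup p t) * (Poly_Mapping.single t 1 - r t))"
          by (subst (1) poly_mapping_expand)
            (simp add: g_def sum_subtractf right_diff_distrib mult_single)
        also have "\<dots> \<in> I" using r(2) p(1) by (intro sum_mem scalar_mem) blast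
        finally have "coset p = coset g"
          using p(1) car[OF keys] by (intro coset_eq_of_minus_mem) (auto simp: cox_carrier_iff piece_monomials_def)
        also have "g = (\<Sum>t\<in>T. Poly_Mapping.single t (Poly_Mapping.lookup g t))"
          by (subst poly_mapping_expand, rule sum.mono_neutral_left)
            (use fin keys in \<open>auto simp: in_keys_iff\<close>)
        also have "\<dots> = (\<Sum>t\<in>T. Poly_Mapping.single t (Poly_Mapping.lookup g (inv_into T e (e t))))"
          using inj by (intro sum.cong) auto
        also have "coset \<dots> = V.lincomb (\<lambda>v. Poly_Mapping.lookup g (inv_into T e v)) (e ` T)"
          using comb by simp
        finally show "X \<in> V.span (e ` T)"
          unfolding p(2) V.span_def using fin by auto
      qed
    qed
  qed
  then have "V.dim = card (e ` T)" using fin by (intro V.dim_basis) auto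
  then show ?thesis using card_image[OF inj] by (simp add: hilbert_fun_def V_def)
qed

section \<open>Macaulay inverse systems of an ideal\<close>

lemma finite_cox_vars: "finite (cox_vars s n)"
proof -
  have "cox_vars s n = (SIGMA i:{1..s}. {..n i})" by (auto simp: cox_vars_def)
  then show ?thesis by simp
qed

lemma multideg_eq_deg_in:
  assumes "Poly_Mapping.keys t \<subseteq> cox_vars s n" "i \<in> {1..s}"
  shows "multideg t i = int (deg_in ({i} \<times> {..n i}) t)"
proof -
  have "multideg t i = (\<Sum>x\<in>cox_vars s n. int (Poly_Mapping.lookup t x) * of_bool (fst x = i))"
    unfolding multideg_def using assms(1) finite_cox_vars
    by (intro sum.mono_neutral_left) (auto simp: in_keys_iff)
  also have "\<dots> = (\<Sum>x\<in>{i} \<times> {..n i}. int (Poly_Mapping.lookup t x) * of_bool (fst x = i))"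
    using assms(2) finite_cox_vars
    by (intro sum.mono_neutral_right) (auto simp: cox_vars_def)
  also have "\<dots> = (\<Sum>x\<in>{i} \<times> {..n i}. int (Poly_Mapping.lookup t x))"
    by (intro sum.cong) auto
  finally show ?thesis by (simp add: deg_in_def)
qed

lemma multideg_add: "multideg (t + r) i = multideg t i + multideg r i"
proof -
  have *: "multideg q i = (\<Sum>x\<in>Poly_Mapping.keys t \<union> Poly_Mapping.keys r.
      int (Poly_Mapping.lookup q x) * of_bool (fst x = i))"
    if "Poly_Mapping.keys q \<subseteq> Poly_Mapping.keys t \<union> Poly_Mapping.keys r" for q
    unfolding multideg_def using that by (intro sum.mono_neutral_left) (auto simp: in_keys_iff)
  show ?thesis
    using *[of t] *[of r] *[of "t + r"]
    by (simp add: keys_monomial_add lookup_add sum.distrib distrib_right)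
qed

lemma multideg_single: "multideg (Poly_Mapping.single (j, l) 1) i = of_bool (j = i)"
  by (simp add: multideg_def)

lemma finite_piece_monomials: "finite (piece_monomials s n u)"
proof -
  let ?F = "{f. \<forall>x. (x \<in> cox_vars s n \<longrightarrow> f x \<in> {..\<Sum>i\<in>{1..s}. u i}) \<and> (x \<notin> cox_vars s n \<longrightarrow> f x = 0)}"
  have "Poly_Mapping.lookup ` piece_monomials s n u \<subseteq> ?F"
  proof (intro subsetI CollectI, elim imageE, intro allI conjI impI)
    fix f t x assume t: "f = Poly_Mapping.lookup t" "t \<in> piece_monomials s n u"
    { assume x: "x \<in> cox_vars s n"
      obtain i j where ij: "x = (i, j)" "i \<in> {1..s}" "j \<le> n i" using x by (auto simp: cox_vars_def)
      have "f x \<le> deg_in ({i} \<times> {..n i}) t"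
        unfolding deg_in_def t(1) using ij by (intro member_le_sum) auto
      also have "\<dots> = u i"
        using multideg_eq_deg_in[of t s n i] t(2) ij(2) by (auto simp: piece_monomials_def)
      also have "\<dots> \<le> (\<Sum>i\<in>{1..s}. u i)" using ij(2) by (intro member_le_sum) auto
      finally show "f x \<in> {..\<Sum>i\<in>{1..s}. u i}" by simp }
    { assume x: "x \<notin> cox_vars s n"
      then show "f x = 0" using t by (auto simp: piece_monomials_def in_keys_iff) }
  qed
  moreover have "finite ?F" using finite_cox_vars by (intro finite_set_of_finite_funs) auto
  ultimately have "finite (Poly_Mapping.lookup ` piece_monomials s n u)" using finite_subset by blast
  then show ?thesis by (rule finite_imageD) (auto intro: inj_onI poly_mapping_eqI)
qed

lemma piece_monomials_add_variable:
  assumes v: "v \<in> {i} \<times> {..n i}" and i: "i \<in> {1..s}"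
  shows "t + Poly_Mapping.single v 1 \<in> piece_monomials s n (u(i := Suc a)) \<longleftrightarrow> t \<in> piece_monomials s n (u(i := a))"
proof -
  obtain j where j: "v = (i, j)" "j \<le> n i" using v by auto
  have "v \<in> cox_vars s n" using j i by (auto simp: cox_vars_def)
  moreover have "multideg (Poly_Mapping.single v 1) k = of_bool (i = k)" for k
    unfolding j(1) by (rule multideg_single)
  ultimately show ?thesis using i by (auto simp: piece_monomials_def keys_monomial_add multideg_add)
qed

text \<open>The persistence argument needs an infinite field, whereas \<open>k\<close> may be finite. Functions on monomials
  therefore take their values in the rational function field \<open>k(z)\<close>, in which \<open>k\<close> is embedded as the
  constants. Only the dual side is extended; the ideal and its Hilbert function stay over \<open>k\<close>.\<close>
definition emb :: "'k::field \<Rightarrow> 'k poly fract" where "emb c = to_fract [:c:]"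

lemma emb_simps [simp]:
  "emb 0 = 0" "emb 1 = 1" "emb (c + d) = emb c + emb d" "emb (c * d) = emb c * emb d"
  "emb (- c) = - emb c"
  by (simp_all add: emb_def flip: to_fract_add to_fract_mult to_fract_uminus one_pCons)

lemma emb_sum: "emb (\<Sum>i\<in>A. f i) = (\<Sum>i\<in>A. emb (f i))"
  by (induction A rule: infinite_finite_induct) auto

lemma infinite_UNIV_fract: "infinite (UNIV :: ('k::field) poly fract set)"
proof
  assume "finite (UNIV :: 'k poly fract set)"
  moreover have "inj (\<lambda>k::nat. to_fract (Polynomial.monom (1::'k) k))"
  proof (rule injI)
    fix k l :: nat
    assume "to_fract (Polynomial.monom (1::'k) k) = to_fract (Polynomial.monom 1 l)"
    then have "Polynomial.degree (Polynomial.monom (1::'k) k) = Polynomial.degree (Polynomial.monom (1::'k) l)"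
      by simp
    then show "k = l" by (simp add: degree_monom_eq)
  qed
  ultimately show False by (metis finite_imageD finite_subset infinite_UNIV_nat subset_UNIV)
qed

definition pairing :: "('a \<Rightarrow>\<^sub>0 'k::field) \<Rightarrow> ('a \<Rightarrow> 'k poly fract) \<Rightarrow> 'k poly fract" where
  "pairing f \<phi> = (\<Sum>t\<in>Poly_Mapping.keys f. emb (Poly_Mapping.lookup f t) * \<phi> t)"

lemma pairing_superset:
  assumes "finite A" "Poly_Mapping.keys f \<subseteq> A"
  shows "pairing f \<phi> = (\<Sum>t\<in>A. emb (Poly_Mapping.lookup f t) * \<phi> t)"
  unfolding pairing_def using assms by (intro sum.mono_neutral_left) (auto simp: in_keys_iff)

lemma keys_uminus: "Poly_Mapping.keys (- f) = Poly_Mapping.keys f"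
  for f :: "'a \<Rightarrow>\<^sub>0 'k::ab_group_add"
  by (auto simp: in_keys_iff)

lemma pairing_simps [simp]:
  "pairing 0 \<phi> = 0" "pairing (Poly_Mapping.single t c) \<phi> = emb c * \<phi> t"
  "pairing (- f) \<phi> = - pairing f \<phi>"
  by (auto simp: pairing_def sum_negf keys_uminus)

lemma pairing_add [simp]: "pairing (f + g) \<phi> = pairing f \<phi> + pairing g \<phi>"
  using pairing_superset[of "Poly_Mapping.keys f \<union> Poly_Mapping.keys g" f \<phi>]
    pairing_superset[of "Poly_Mapping.keys f \<union> Poly_Mapping.keys g" g \<phi>]
    pairing_superset[of "Poly_Mapping.keys f \<union> Poly_Mapping.keys g" "f + g" \<phi>]
    keys_add[of f g]
  by (simp add: lookup_add distrib_right sum.distrib)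

lemma pairing_diff [simp]: "pairing (f - g) \<phi> = pairing f \<phi> - pairing g \<phi>"
  using pairing_add[of f "- g" \<phi>] by (simp del: pairing_add)

lemma pairing_sum: "pairing (\<Sum>i\<in>A. f i) \<phi> = (\<Sum>i\<in>A. pairing (f i) \<phi>)"
  by (induction A rule: infinite_finite_induct) auto

lemma pairing_mult:
  fixes p q :: "'a::monoid_add \<Rightarrow>\<^sub>0 'k::field"
  shows "pairing (p * q) \<phi> =
    (\<Sum>r\<in>Poly_Mapping.keys p. emb (Poly_Mapping.lookup p r) * pairing q (\<lambda>t. \<phi> (r + t)))"
proof -
  have "p * q = (\<Sum>r\<in>Poly_Mapping.keys p. \<Sum>t\<in>Poly_Mapping.keys q.
      Poly_Mapping.single (r + t) (Poly_Mapping.lookup p r * Poly_Mapping.lookup q t))"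
    by (subst poly_mapping_expand[of p], subst poly_mapping_expand[of q])
      (simp add: sum_product mult_single)
  then have "pairing (p * q) \<phi> = (\<Sum>r\<in>Poly_Mapping.keys p. \<Sum>t\<in>Poly_Mapping.keys q.
      emb (Poly_Mapping.lookup p r) * (emb (Poly_Mapping.lookup q t) * \<phi> (r + t)))"
    by (simp add: pairing_sum mult.assoc)
  then show ?thesis by (simp add: pairing_def[of q] sum_distrib_left)
qed

lemma pairing_linear [simp]:
  "pairing f (\<lambda>t. 0) = 0"
  "pairing f (\<lambda>t. \<phi> t + \<psi> t) = pairing f \<phi> + pairing f \<psi>"
  "pairing f (\<lambda>t. c * \<phi> t) = c * pairing f \<phi>"
  by (simp_all add: pairing_def distrib_left sum.distrib sum_distrib_left mult.left_commute)

definition inverse_system ::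
    "nat \<Rightarrow> (nat \<Rightarrow> nat) \<Rightarrow> ('k::field) cox_poly set \<Rightarrow> (nat \<Rightarrow> nat) \<Rightarrow> (monomial \<Rightarrow> 'k poly fract) set" where
  "inverse_system s n I u =
     {\<phi>. (\<forall>t. \<phi> t \<noteq> 0 \<longrightarrow> t \<in> piece_monomials s n u) \<and> (\<forall>f\<in>I. pairing f \<phi> = 0)}"

lemma subspace_inverse_system: "funsp.subspace (inverse_system s n I u)"
  unfolding funsp.subspace_def inverse_system_def
  by (auto simp: plus_fun_def zero_fun_def) (metis add.right_neutral)+

lemma finite_support_in_span:
  fixes \<Phi> :: "('a \<Rightarrow> 'k::field) set"
  assumes "finite X" "\<And>\<phi> t. \<phi> \<in> \<Phi> \<Longrightarrow> \<phi> t \<noteq> 0 \<Longrightarrow> t \<in> X"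
  shows "\<exists>F. finite F \<and> \<Phi> \<subseteq> funsp.span F"
proof (intro exI conjI subsetI)
  let ?\<delta> = "\<lambda>x t. of_bool (t = x) :: 'k"
  show "finite (?\<delta> ` X)" using assms(1) by simp
  fix \<phi> assume phi: "\<phi> \<in> \<Phi>"
  have "\<phi> = (\<Sum>x\<in>X. (\<lambda>t. \<phi> x * ?\<delta> x t))"
  proof
    fix t
    have "(\<Sum>x\<in>X. (\<lambda>t. \<phi> x * ?\<delta> x t)) t = (\<Sum>x\<in>X. if x = t then \<phi> x else 0)"
      unfolding sum_fun_apply by (intro sum.cong) auto
    also have "\<dots> = \<phi> t" using assms(1) assms(2)[OF phi, of t] by auto
    finally show "\<phi> t = (\<Sum>x\<in>X. (\<lambda>t. \<phi> x * ?\<delta> x t)) t" by simp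
  qed
  also have "\<dots> \<in> funsp.span (?\<delta> ` X)"
    by (intro funsp.span_sum funsp.span_scale funsp.span_base) auto
  finally show "\<phi> \<in> funsp.span (?\<delta> ` X)" .
qed

lemma inverse_system_homog:
  assumes "i \<in> {1..s}"
  shows "inverse_system s n I (u(i := a)) \<subseteq> homog ({i} \<times> {..n i}) a"
  using assms multideg_eq_deg_in[of _ s n i]
  by (fastforce simp: inverse_system_def homog_def piece_monomials_def)

lemma (in cox_ideal) contract_inverse_system:
  assumes i: "i \<in> {1..s}" and v: "v \<in> {i} \<times> {..n i}"
    and phi: "\<phi> \<in> inverse_system s n I (u(i := Suc a))"
  shows "contract v \<phi> \<in> inverse_system s n I (u(i := a))"
  unfolding inverse_system_def
proof (intro CollectI conjI allI impI ballI)
  fix t assume "contract v \<phi> t \<noteq> 0"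
  then have "t + Poly_Mapping.single v 1 \<in> piece_monomials s n (u(i := Suc a))"
    using phi by (auto simp: inverse_system_def contract_def)
  then show "t \<in> piece_monomials s n (u(i := a))" using piece_monomials_add_variable[where n = n, OF v i] by simp
next
  fix f assume f: "f \<in> I"
  let ?x = "Poly_Mapping.single (Poly_Mapping.single v 1) (1::'k)"
  have "v \<in> cox_vars s n" using i v by (auto simp: cox_vars_def)
  then have "?x * f \<in> I" using f by (intro mult_mem cox_carrier_closed) auto
  then have "pairing (?x * f) \<phi> = 0" using phi by (auto simp: inverse_system_def)
  then show "pairing f (contract v \<phi>) = 0"
    by (simp add: pairing_mult contract_def [abs_def] add.commute)
qed

lemma lookup_scalar_mult:
  "Poly_Mapping.lookup (Poly_Mapping.single 0 c * f) x = c * Poly_Mapping.lookup f x"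
  for f :: "'a::monoid_add \<Rightarrow>\<^sub>0 'k::semiring_0"
  by (simp add: map.rep_eq when_def flip: mult_map_scale_conv_mult)

lemma cox_ring_a_inv:
  "p \<in> carrier (cox_ring s n) \<Longrightarrow> \<ominus>\<^bsub>cox_ring s n\<^esub> p = - p"
  by (rule abelian_group.minus_equality[OF ring.is_abelian_group[OF cring.axioms(1)[OF cox_ring_cring]]])
    (simp_all add: cox_carrier_closed)

lemma annihilator_ideal:
  fixes \<psi> :: "monomial \<Rightarrow> ('k::field) poly fract"
  shows "ideal {f \<in> carrier (cox_ring s n). \<forall>q\<in>carrier (cox_ring s n). pairing (q * f) \<psi> = 0} (cox_ring s n)"
  (is "ideal ?A _")
proof (rule idealI)
  show "ring (cox_ring s n)" by (rule cring.axioms(1)[OF cox_ring_cring])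
  show "subgroup ?A (add_monoid (cox_ring s n))"
  proof
    fix f assume f: "f \<in> ?A"
    have "inv\<^bsub>add_monoid (cox_ring s n)\<^esub> f = - f"
      using cox_ring_a_inv[of f s n] f by (simp add: a_inv_def)
    then show "inv\<^bsub>add_monoid (cox_ring s n)\<^esub> f \<in> ?A"
      using f by (auto simp: cox_carrier_closed)
  qed (auto simp: cox_carrier_closed distrib_left)
  fix f x :: "'k cox_poly" assume f: "f \<in> ?A" and x: "x \<in> carrier (cox_ring s n)"
  have "x * f \<in> ?A"
  proof (intro CollectI conjI ballI)
    show "x * f \<in> carrier (cox_ring s n)" using f x by (simp add: cox_carrier_closed)
    fix q :: "'k cox_poly" assume "q \<in> carrier (cox_ring s n)"
    then have "pairing ((q * x) * f) \<psi> = 0" using f cox_carrier_closed(5)[of q s n x] x by blast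
    then show "pairing (q * (x * f)) \<psi> = 0" by (simp add: mult.assoc)
  qed
  then show "x \<otimes>\<^bsub>cox_ring s n\<^esub> f \<in> ?A" "f \<otimes>\<^bsub>cox_ring s n\<^esub> x \<in> ?A"
    by (simp_all add: mult.commute)
qed

text \<open>This is where the degrees of the generators enter. In degree \<open>u + e\<^sub>i\<close> with \<open>u \<ge> d\<close>, every monomial
  multiple of a generator has a cofactor of positive degree in the \<open>i\<close>-th group of variables, so it is
  \<open>x\<^sub>v f\<close> with \<open>f \<in> I\<close> for a variable \<open>x\<^sub>v\<close> of that group; pairing it with \<open>\<psi>\<close> is pairing
  \<open>f\<close> with the contraction of \<open>\<psi>\<close> by \<open>x\<^sub>v\<close>. Hence \<open>\<psi>\<close> annihilates all multiples of the generators,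
  and the polynomials all of whose multiples it annihilates form an ideal.\<close>
lemma (in cox_ideal) inverse_system_glue:
  assumes gen: "generated_in_degrees_le s n d I" and i: "i \<in> {1..s}"
    and d: "\<And>j. j \<in> {1..s} \<Longrightarrow> d j \<le> int ((u(i := a)) j)"
    and hom: "\<psi> \<in> homog ({i} \<times> {..n i}) (Suc a)"
    and contr: "\<And>v. v \<in> {i} \<times> {..n i} \<Longrightarrow> contract v \<psi> \<in> inverse_system s n I (u(i := a))"
  shows "\<psi> \<in> inverse_system s n I (u(i := Suc a))"
proof -
  let ?J = "{i} \<times> {..n i}"
  have supp: "t \<in> piece_monomials s n (u(i := Suc a))" if "\<psi> t \<noteq> 0" for t
  proof -
    have "deg_in ?J t = Suc a" using hom that by (auto simp: homog_def)
    then obtain v where v: "v \<in> ?J" "Poly_Mapping.lookup t v \<noteq> 0" by (rule deg_in_pos_factor)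
    note t = monomial_factor[OF v(2)]
    have "contract v \<psi> (t - Poly_Mapping.single v 1) \<noteq> 0" using that t by (simp add: contract_def)
    then have "t - Poly_Mapping.single v 1 \<in> piece_monomials s n (u(i := a))"
      using contr[OF v(1)] by (auto simp: inverse_system_def)
    then show ?thesis using piece_monomials_add_variable[where n = n, OF v(1) i] t by metis
  qed
  obtain G where G: "G \<subseteq> carrier (cox_ring s n)"
      "\<And>g. g \<in> G \<Longrightarrow> \<exists>b. g \<in> cox_piece s n b \<and> (\<forall>i\<in>{1..s}. b i \<le> d i)"
      "I = genideal (cox_ring s n) G"
    using gen unfolding generated_in_degrees_le_def by blast
  have GI: "G \<subseteq> I" unfolding G(3) by (rule genideal_self[OF G(1)])
  have shift: "pairing g (\<lambda>t. \<psi> (r + t)) = 0"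
    if g: "g \<in> G" and r: "Poly_Mapping.keys r \<subseteq> cox_vars s n" for g r
  proof (cases "\<exists>t\<in>Poly_Mapping.keys g. \<psi> (r + t) \<noteq> 0")
    case False
    then show ?thesis by (simp add: pairing_def)
  next
    case True
    then obtain t where t: "t \<in> Poly_Mapping.keys g" "\<psi> (r + t) \<noteq> 0" by blast
    obtain b where b: "g \<in> cox_piece s n b" "b i \<le> d i" using G(2)[OF g] i by blast
    have "multideg r i + multideg t i = int (Suc a)"
      using supp[OF t(2)] i by (simp add: piece_monomials_def multideg_add)
    moreover have "multideg t i \<le> int a" using b t(1) d[OF i] i by (auto simp: cox_piece_def)
    ultimately have "deg_in ?J r \<noteq> 0" using multideg_eq_deg_in[OF r i] by simp
    then obtain v where v: "v \<in> ?J" "Poly_Mapping.lookup r v \<noteq> 0"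
      using deg_in_pos_factor not0_implies_Suc by metis
    define r' where "r' = r - Poly_Mapping.single v 1"
    have rr': "r' + Poly_Mapping.single v 1 = r" unfolding r'_def by (rule monomial_factor[OF v(2)])
    have "Poly_Mapping.keys r' \<subseteq> cox_vars s n"
      using r unfolding rr'[symmetric] by (simp add: keys_monomial_add)
    then have "Poly_Mapping.single r' 1 * g \<in> I"
      using g GI by (intro mult_mem cox_carrier_closed) auto
    then have "pairing (Poly_Mapping.single r' 1 * g) (contract v \<psi>) = 0"
      using contr[OF v(1)] by (auto simp: inverse_system_def)
    then have "pairing g (\<lambda>t. contract v \<psi> (r' + t)) = 0" by (simp add: pairing_mult)
    also have "(\<lambda>t. contract v \<psi> (r' + t)) = (\<lambda>t. \<psi> (r + t))"
      unfolding rr'[symmetric] contract_def by (simp add: ac_simps)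
    finally show ?thesis .
  qed
  let ?A = "{f \<in> carrier (cox_ring s n). \<forall>q\<in>carrier (cox_ring s n). pairing (q * f) \<psi> = 0}"
  have "G \<subseteq> ?A"
  proof (intro subsetI CollectI conjI ballI)
    fix g q :: "'k cox_poly" assume g: "g \<in> G" and q: "q \<in> carrier (cox_ring s n)"
    show "pairing (q * g) \<psi> = 0"
      unfolding pairing_mult using q shift[OF g] by (intro sum.neutral) (auto simp: cox_carrier_iff)
  qed (use G(1) in blast)
  then have "I \<subseteq> ?A" unfolding G(3) by (rule genideal_minimal[OF annihilator_ideal])
  then have "pairing f \<psi> = 0" if "f \<in> I" for f
    using that cox_carrier_closed(2) by (metis (mono_tags, lifting) mem_Collect_eq mult_1 subsetD)
  then show ?thesis using supp by (simp add: inverse_system_def)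
qed

text \<open>A maximal set of monomials of degree \<open>u\<close> that is independent modulo \<open>I\<close>: by maximality, adding any
  other monomial \<open>t\<close> creates an element of \<open>I\<close> in which \<open>t\<close> occurs, and this reduces \<open>t\<close>.\<close>
lemma (in cox_ideal) standard_monomials_exist:
  obtains T where "T \<subseteq> piece_monomials s n u"
    "\<And>f. f \<in> I \<Longrightarrow> Poly_Mapping.keys f \<subseteq> T \<Longrightarrow> f = 0"
    "\<And>t. t \<in> piece_monomials s n u \<Longrightarrow> \<exists>r. Poly_Mapping.keys r \<subseteq> T \<and> Poly_Mapping.single t 1 - r \<in> I"
proof -
  define P where "P T \<longleftrightarrow> T \<subseteq> piece_monomials s n u \<and> (\<forall>f\<in>I. Poly_Mapping.keys f \<subseteq> T \<longrightarrow> f = 0)" for T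
  have "{T. P T} \<subseteq> Pow (piece_monomials s n u)" by (auto simp: P_def)
  then have "finite {T. P T}" using finite_piece_monomials finite_subset by blast
  moreover have "P {}" by (auto simp: P_def)
  ultimately obtain T where T: "P T" and max: "\<And>T'. P T' \<Longrightarrow> T \<subseteq> T' \<Longrightarrow> T' = T"
    using finite_has_maximal[of "{T. P T}"] by auto
  have "\<exists>r. Poly_Mapping.keys r \<subseteq> T \<and> Poly_Mapping.single t 1 - r \<in> I" if t: "t \<in> piece_monomials s n u" for t
  proof (cases "t \<in> T")
    case True
    then show ?thesis using zero_mem by (intro exI[of _ "Poly_Mapping.single t 1"]) auto
  next
    case False
    then have "\<not> P (insert t T)" using max by blast
    then obtain f where f: "f \<in> I" "Poly_Mapping.keys f \<subseteq> insert t T" "f \<noteq> 0"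
      using T t by (auto simp: P_def)
    define c where "c = Poly_Mapping.lookup f t"
    have "\<not> Poly_Mapping.keys f \<subseteq> T" using f T by (auto simp: P_def)
    then have c: "c \<noteq> 0" using f(2) by (auto simp: c_def in_keys_iff)
    define r where "r = Poly_Mapping.single t 1 - Poly_Mapping.single 0 (inverse c) * f"
    have "Poly_Mapping.keys r \<subseteq> T"
      using f(2) c by (auto simp: r_def in_keys_iff lookup_minus lookup_scalar_mult lookup_single c_def when_def split: if_splits)
    moreover have "Poly_Mapping.single t 1 - r \<in> I" using f(1) by (simp add: r_def scalar_mem)
    ultimately show ?thesis by blast
  qed
  then show ?thesis using that T unfolding P_def by blast
qed

text \<open>The extension of scalars leaves the dimension unchanged because the standard monomials have a dual
  basis with entries in \<open>k\<close>: the function \<open>\<delta> c\<close> sends \<open>t\<close> to the coefficient of \<open>c\<close> in the normal form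
  \<open>r t\<close>. It annihilates \<open>I\<close> since the normal form of the degree \<open>u\<close> component of an element of \<open>I\<close> is zero;
  this uses that \<open>I\<close> contains the homogeneous components of its elements.\<close>
lemma (in cox_ideal) dim_inverse_system:
  assumes hom: "\<And>p a. p \<in> I \<Longrightarrow> hom_component s a p \<in> I"
  shows "funsp.dim (inverse_system s n I u) = hilbert_fun s n I u"
proof -
  let ?X = "piece_monomials s n u"
  obtain T where T: "T \<subseteq> ?X"
    and indep: "\<And>f. f \<in> I \<Longrightarrow> Poly_Mapping.keys f \<subseteq> T \<Longrightarrow> f = 0"
    and gen: "\<And>t. t \<in> ?X \<Longrightarrow> \<exists>r. Poly_Mapping.keys r \<subseteq> T \<and> Poly_Mapping.single t 1 - r \<in> I"
    using standard_monomials_exist[of u] by metis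
  have fin: "finite T" using T finite_piece_monomials finite_subset by blast
  obtain r where r: "\<And>t. t \<in> ?X \<Longrightarrow> Poly_Mapping.keys (r t) \<subseteq> T"
      "\<And>t. t \<in> ?X \<Longrightarrow> Poly_Mapping.single t 1 - r t \<in> I"
    using gen by metis
  define \<delta> where "\<delta> c t = (if t \<in> ?X then emb (Poly_Mapping.lookup (r t) c) else 0)" for c t
  have rT: "r t = Poly_Mapping.single t 1" if "t \<in> T" for t
  proof -
    have "Poly_Mapping.single t 1 - r t = 0"
    proof (rule indep)
      show "Poly_Mapping.keys (Poly_Mapping.single t 1 - r t) \<subseteq> T"
        using keys_diff[of "Poly_Mapping.single t 1" "r t"] r(1)[of t] that T by auto
    qed (use r(2) that T in auto)
    then show ?thesis by simp
  qed
  have dT: "\<delta> c t = of_bool (c = t)" if "c \<in> T" "t \<in> T" for c t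
    using that rT T by (auto simp: \<delta>_def lookup_single when_def)
  have mem: "\<delta> c \<in> inverse_system s n I u" for c
    unfolding inverse_system_def
  proof (intro CollectI conjI allI impI ballI)
    show "t \<in> ?X" if "\<delta> c t \<noteq> 0" for t using that by (auto simp: \<delta>_def split: if_splits)
    fix f assume f: "f \<in> I"
    let ?Y = "Poly_Mapping.keys f \<inter> ?X"
    define g where "g = (\<Sum>t\<in>?Y. Poly_Mapping.single 0 (Poly_Mapping.lookup f t) * r t)"
    have Y: "{t \<in> Poly_Mapping.keys f. \<forall>i\<in>{1..s}. multideg t i = int (u i)} = ?Y"
      using mem_carrier[OF f] by (auto simp: piece_monomials_def cox_carrier_iff)
    have comp: "hom_component s (\<lambda>i. int (u i)) f = (\<Sum>t\<in>?Y. Poly_Mapping.single t (Poly_Mapping.lookup f t))"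
      unfolding hom_component_def Y ..
    have "g = hom_component s (\<lambda>i. int (u i)) f -
        (\<Sum>t\<in>?Y. Poly_Mapping.single 0 (Poly_Mapping.lookup f t) * (Poly_Mapping.single t 1 - r t))"
      unfolding comp g_def by (simp add: right_diff_distrib mult_single sum_subtractf)
    also have "\<dots> \<in> I"
      by (rule minus_mem[OF hom[OF f]], intro sum_mem scalar_mem r(2)) simp
    finally have "g \<in> I" .
    moreover have "Poly_Mapping.keys g \<subseteq> T"
      unfolding g_def using r(1) keys_scalar_mult by (intro keys_sum_subset) blast
    ultimately have "g = 0" by (rule indep)
    have "pairing f (\<delta> c) = (\<Sum>t\<in>?Y. emb (Poly_Mapping.lookup f t) * \<delta> c t)"
      unfolding pairing_def by (rule sum.mono_neutral_right) (auto simp: \<delta>_def)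
    also have "\<dots> = (\<Sum>t\<in>?Y. emb (Poly_Mapping.lookup (Poly_Mapping.single 0 (Poly_Mapping.lookup f t) * r t) c))"
      by (intro sum.cong refl) (simp add: \<delta>_def lookup_scalar_mult)
    also have "\<dots> = emb (Poly_Mapping.lookup g c)" by (simp add: g_def lookup_sum emb_sum)
    finally show "pairing f (\<delta> c) = 0" using \<open>g = 0\<close> by simp
  qed
  have expand: "\<phi> = (\<Sum>c\<in>T. (\<lambda>t. \<phi> c * \<delta> c t))" if phi: "\<phi> \<in> inverse_system s n I u" for \<phi>
  proof
    fix t
    show "\<phi> t = (\<Sum>c\<in>T. (\<lambda>t. \<phi> c * \<delta> c t)) t"
    proof (cases "t \<in> ?X")
      case True
      have "pairing (Poly_Mapping.single t 1 - r t) \<phi> = 0" using r(2)[OF True] phi by (auto simp: inverse_system_def)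
      then have "\<phi> t = pairing (r t) \<phi>" by simp
      also have "\<dots> = (\<Sum>c\<in>T. \<phi> c * \<delta> c t)"
        using True by (simp add: pairing_superset[OF fin r(1)[OF True]] \<delta>_def mult.commute)
      finally show ?thesis by (simp add: sum_fun_apply)
    next
      case False
      then have "\<phi> t = 0" using phi by (auto simp: inverse_system_def)
      then show ?thesis using False by (simp add: sum_fun_apply \<delta>_def)
    qed
  qed
  have inj: "inj_on \<delta> T"
  proof
    fix c c' assume c: "c \<in> T" "c' \<in> T" "\<delta> c = \<delta> c'"
    have "of_bool (c' = c) = \<delta> c c" unfolding c(3) using dT[OF c(2,1)] by (rule sym)
    also have "\<dots> = 1" using dT[OF c(1,1)] by simp
    finally show "c = c'" by (auto split: if_splits simp: of_bool_def)
  qed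
  have "funsp.independent (\<delta> ` T)"
  proof (rule funsp.independent_if_scalars_zero)
    fix k x assume sum: "(\<Sum>x\<in>\<delta> ` T. (\<lambda>t. k x * x t)) = 0" and "x \<in> \<delta> ` T"
    then obtain c where c: "c \<in> T" "x = \<delta> c" by auto
    have "0 = (\<Sum>x\<in>\<delta> ` T. (\<lambda>t. k x * x t)) c" using sum by simp
    also have "\<dots> = (\<Sum>b\<in>T. k (\<delta> b) * \<delta> b c)" by (simp add: sum_fun_apply sum.reindex[OF inj])
    also have "\<dots> = (\<Sum>b\<in>T. if b = c then k (\<delta> b) else 0)" using dT c(1) by (intro sum.cong) auto
    also have "\<dots> = k x" using fin c by simp
    finally show "k x = 0" by simp
  qed (use fin in simp)
  moreover have "\<delta> ` T \<subseteq> inverse_system s n I u" using mem by blast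
  moreover have "inverse_system s n I u \<subseteq> funsp.span (\<delta> ` T)"
  proof
    fix \<phi> assume "\<phi> \<in> inverse_system s n I u"
    then have "\<phi> = (\<Sum>c\<in>T. (\<lambda>t. \<phi> c * \<delta> c t))" by (rule expand)
    also have "\<dots> \<in> funsp.span (\<delta> ` T)"
      by (intro funsp.span_sum funsp.span_scale funsp.span_base) auto
    finally show "\<phi> \<in> funsp.span (\<delta> ` T)" .
  qed
  ultimately have "funsp.dim (inverse_system s n I u) = card (\<delta> ` T)"
    using funsp.basis_card_eq_dim by metis
  also have "\<dots> = hilbert_fun s n I u"
    using card_image[OF inj] hilbert_fun_eq_card[OF fin T indep gen] by simp
  finally show ?thesis .
qed

lemma (in cox_ideal) hilbert_fun_persistence:
  assumes hom: "\<And>p a. p \<in> I \<Longrightarrow> hom_component s a p \<in> I"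
    and gen: "generated_in_degrees_le s n d I" and i: "i \<in> {1..s}" and "m \<le> b"
    and d: "\<And>j. j \<in> {1..s} \<Longrightarrow> d j \<le> int ((u(i := b)) j)"
    and "hilbert_fun s n I (u(i := b)) = m" "hilbert_fun s n I (u(i := Suc b)) = m"
    and "b \<le> a"
  shows "hilbert_fun s n I (u(i := a)) = m"
proof -
  have "funsp.dim (inverse_system s n I (u(i := a))) = m"
  proof (rule inverse_system_persistence[where J = "{i} \<times> {..n i}" and d = b and
        \<Phi> = "\<lambda>a. inverse_system s n I (u(i := a))"])
    show "infinite (UNIV :: 'k poly fract set)" by (rule infinite_UNIV_fract)
    show "funsp.subspace (inverse_system s n I (u(i := a)))" for a
      by (rule subspace_inverse_system)
    show "\<exists>F. finite F \<and> inverse_system s n I (u(i := a)) \<subseteq> funsp.span F" for a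
      by (rule finite_support_in_span[OF finite_piece_monomials[of s n "u(i := a)"]])
        (auto simp: inverse_system_def)
    show "inverse_system s n I (u(i := a)) \<subseteq> homog ({i} \<times> {..n i}) a" for a
      by (rule inverse_system_homog[OF i])
    show "contract v \<phi> \<in> inverse_system s n I (u(i := a))"
      if "\<phi> \<in> inverse_system s n I (u(i := Suc a))" "v \<in> {i} \<times> {..n i}" for a v \<phi>
      by (rule contract_inverse_system[OF i that(2,1)])
    show "\<psi> \<in> inverse_system s n I (u(i := Suc a))"
      if "b \<le> a" "\<psi> \<in> homog ({i} \<times> {..n i}) (Suc a)"
        "\<And>v. v \<in> {i} \<times> {..n i} \<Longrightarrow> contract v \<psi> \<in> inverse_system s n I (u(i := a))" for a \<psi>
    proof (rule inverse_system_glue[OF gen i _ that(2,3)])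
      show "d j \<le> int ((u(i := a)) j)" if "j \<in> {1..s}" for j
        using d[OF that] \<open>b \<le> a\<close> by (auto split: if_splits)
    qed
  qed (use assms dim_inverse_system[OF hom] in auto)
  then show ?thesis using dim_inverse_system[OF hom] by simp
qed

section \<open>Uniqueness of the Hilbert polynomial\<close>

lemma base_expansion_unique:
  fixes f g :: "nat \<Rightarrow> nat"
  assumes "\<And>i. i < l \<Longrightarrow> f i < B" "\<And>i. i < l \<Longrightarrow> g i < B"
    and "(\<Sum>i<l. f i * B ^ i) = (\<Sum>i<l. g i * B ^ i)" "i < l"
  shows "f i = g i"
  using assms
proof (induction l arbitrary: f g i)
  case (Suc l)
  have split: "(\<Sum>i<Suc l. h i * B ^ i) = h 0 + B * (\<Sum>i<l. h (Suc i) * B ^ i)" for h :: "nat \<Rightarrow> nat"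
    by (simp only: sum.lessThan_Suc_shift) (simp add: sum_distrib_left ac_simps)
  have eq: "f 0 + B * (\<Sum>i<l. f (Suc i) * B ^ i) = g 0 + B * (\<Sum>i<l. g (Suc i) * B ^ i)"
    using Suc.prems(3) unfolding split .
  have B: "f 0 < B" "g 0 < B" using Suc.prems(1,2) by auto
  have f0: "f 0 = g 0" using arg_cong[OF eq, of "\<lambda>x. x mod B"] B by simp
  then have tail: "(\<Sum>i<l. f (Suc i) * B ^ i) = (\<Sum>i<l. g (Suc i) * B ^ i)"
    using eq B by simp
  show ?case
  proof (cases i)
    case (Suc j)
    then show ?thesis
      using Suc.IH[of "\<lambda>i. f (Suc i)" "\<lambda>i. g (Suc i)" j] Suc.prems tail by simp
  qed (simp add: f0)
qed simp

text \<open>Kronecker substitution: setting \<open>t\<^sub>i = x\<^bsup>B^i\<^esup>\<close> with \<open>B\<close> larger than all occurring exponents turns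
  distinct monomials into distinct powers of \<open>x\<close>, and large natural numbers \<open>x\<close> give admissible
  points, so two univariate polynomials agree at infinitely many places.\<close>
lemma rat_mpoly_eqI_eventually:
  assumes P: "P \<in> rat_mpolys s" and Q: "Q \<in> rat_mpolys s"
    and eq: "\<And>u :: nat \<Rightarrow> nat. (\<forall>i\<in>{1..s}. N \<le> u i) \<Longrightarrow>
      eval_mpoly P (\<lambda>i. of_nat (u i)) = eval_mpoly Q (\<lambda>i. of_nat (u i))"
  shows "P = Q"
proof -
  let ?K = "Poly_Mapping.keys P \<union> Poly_Mapping.keys Q"
  define B where "B = Suc (\<Sum>t\<in>?K. \<Sum>i\<in>Poly_Mapping.keys t. Poly_Mapping.lookup t i)"
  define code where "code t = (\<Sum>i<Suc s. Poly_Mapping.lookup t i * B ^ i)" for t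
  define uni where "uni R = (\<Sum>t\<in>Poly_Mapping.keys R. Polynomial.monom (Poly_Mapping.lookup R t) (code t))"
    for R :: rat_mpoly
  have keys: "Poly_Mapping.keys t \<subseteq> {1..s}" if "t \<in> ?K" for t
    using that P Q by (auto simp: rat_mpolys_def)
  have less: "Poly_Mapping.lookup t i < B" if "t \<in> ?K" for t i
  proof (cases "i \<in> Poly_Mapping.keys t")
    case True
    have "Poly_Mapping.lookup t i \<le> (\<Sum>i\<in>Poly_Mapping.keys t. Poly_Mapping.lookup t i)"
      using True by (intro member_le_sum) auto
    also have "\<dots> \<le> (\<Sum>t\<in>?K. \<Sum>i\<in>Poly_Mapping.keys t. Poly_Mapping.lookup t i)"
      using that by (intro member_le_sum[of t ?K]) auto
    finally show ?thesis by (simp add: B_def)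
  next
    case False
    then show ?thesis by (simp add: in_keys_iff B_def)
  qed
  have inj: "inj_on code ?K"
  proof
    fix t t' assume t: "t \<in> ?K" "t' \<in> ?K" and "code t = code t'"
    have le: "Poly_Mapping.lookup t i = Poly_Mapping.lookup t' i" if "i < Suc s" for i
      using base_expansion_unique[of "Suc s" "Poly_Mapping.lookup t" B "Poly_Mapping.lookup t'" i]
        less t \<open>code t = code t'\<close> that by (simp add: code_def)
    show "t = t'"
    proof (rule poly_mapping_eqI)
      fix i
      show "Poly_Mapping.lookup t i = Poly_Mapping.lookup t' i"
      proof (cases "i < Suc s")
        case False
        then have "i \<notin> Poly_Mapping.keys t" "i \<notin> Poly_Mapping.keys t'" using keys t by fastforce+
        then show ?thesis by (simp add: in_keys_iff)
      qed (rule le)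
    qed
  qed
  have coeff: "Polynomial.coeff (uni R) (code t) = Poly_Mapping.lookup R t"
    if "Poly_Mapping.keys R \<subseteq> ?K" "t \<in> ?K" for R t
  proof -
    have "Polynomial.coeff (uni R) (code t) =
        (\<Sum>r\<in>Poly_Mapping.keys R. if r = t then Poly_Mapping.lookup R r else 0)"
      unfolding uni_def coeff_sum using inj that
      by (intro sum.cong) (auto simp: inj_on_eq_iff subset_iff)
    then show ?thesis by (simp add: in_keys_iff)
  qed
  have ev: "poly (uni R) x = eval_mpoly R (\<lambda>i. x ^ (B ^ i))"
    if R: "Poly_Mapping.keys R \<subseteq> ?K" for R x
  proof -
    have "x ^ code t = (\<Prod>i\<in>Poly_Mapping.keys t. (x ^ B ^ i) ^ Poly_Mapping.lookup t i)"
      if "t \<in> ?K" for t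
    proof -
      have "code t = (\<Sum>i\<in>Poly_Mapping.keys t. Poly_Mapping.lookup t i * B ^ i)"
        unfolding code_def using keys[OF that]
        by (intro sum.mono_neutral_right) (auto simp: in_keys_iff)
      then show ?thesis by (simp add: power_sum mult.commute flip: power_mult)
    qed
    then show ?thesis using R
      by (auto simp: uni_def eval_mpoly_def poly_sum poly_monom intro!: sum.cong)
  qed
  have roots: "poly (uni P - uni Q) (of_nat k) = 0" if "k \<ge> max N 1" for k
  proof -
    have "N \<le> k ^ (B ^ i)" for i
      using self_le_power[of k "B ^ i"] that by (simp add: B_def)
    then have "eval_mpoly P (\<lambda>i. of_nat (k ^ (B ^ i))) = eval_mpoly Q (\<lambda>i. of_nat (k ^ (B ^ i)))"
      by (intro eq) simp
    then show ?thesis by (simp add: ev)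
  qed
  have "infinite ((of_nat :: nat \<Rightarrow> rat) ` {max N 1..})"
    by (simp add: finite_image_iff infinite_Ici inj_on_def)
  moreover have "of_nat ` {max N 1..} \<subseteq> {x. poly (uni P - uni Q) x = 0}"
    using roots by auto
  ultimately have "uni P - uni Q = 0" using poly_roots_finite finite_subset by blast
  then have "uni P = uni Q" by simp
  have "Poly_Mapping.lookup P t = Poly_Mapping.lookup Q t" if "t \<in> ?K" for t
    using coeff[of P t] coeff[of Q t] that \<open>uni P = uni Q\<close> by simp
  then show ?thesis by (intro poly_mapping_eqI) (metis Un_iff in_keys_iff)
qed

lemma hilbert_poly_eqI:
  assumes "P \<in> rat_mpolys s"
    and "\<And>u. (\<forall>i\<in>{1..s}. N \<le> u i) \<Longrightarrow>
      eval_mpoly P (\<lambda>i. of_nat (u i)) = of_nat (hilbert_fun s n I u)"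
  shows "hilbert_poly s n I = P"
  unfolding hilbert_poly_def
proof (rule the_equality)
  fix Q assume Q: "Q \<in> rat_mpolys s \<and> (\<exists>N. \<forall>u. (\<forall>i\<in>{1..s}. N \<le> u i) \<longrightarrow>
      eval_mpoly Q (\<lambda>i. of_nat (u i)) = of_nat (hilbert_fun s n I u))"
  then obtain M where M: "\<And>u. (\<forall>i\<in>{1..s}. M \<le> u i) \<Longrightarrow>
      eval_mpoly Q (\<lambda>i. of_nat (u i)) = of_nat (hilbert_fun s n I u)" by blast
  show "Q = P"
    by (rule rat_mpoly_eqI_eventually[of _ s _ "max N M"]) (use Q assms M in auto)
qed (use assms in blast)

lemma eval_mpoly_of_nat: "eval_mpoly (of_nat m) v = of_nat m"
proof -
  have "(of_nat m :: rat_mpoly) = Poly_Mapping.single 0 (of_nat m)" by simp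
  then show ?thesis unfolding eval_mpoly_def by (cases "m = 0") (simp_all del: single_of_nat)
qed

lemma of_nat_in_rat_mpolys: "of_nat m \<in> rat_mpolys s"
proof -
  have "(of_nat m :: rat_mpoly) = Poly_Mapping.single 0 (of_nat m)" by simp
  then show ?thesis by (simp add: rat_mpolys_def del: single_of_nat)
qed

section \<open>Constant Hilbert functions persist\<close>

theorem theorem1p2:
  fixes s m :: nat and n :: "nat \<Rightarrow> nat" and d :: "nat \<Rightarrow> int"
    and I :: "('k::field) cox_poly set"
  assumes "homogeneous_ideal s n I"
    and "\<forall>i\<in>{1..s}. 1 \<le> d i"
    and "\<forall>i\<in>{1..s}. int m \<le> d i"
    and "generated_in_degrees_le s n d I"
    and "\<forall>b \<in> {b :: nat \<Rightarrow> nat. \<forall>i\<in>{1..s}. int (b i) \<in> {d i, d i + 1}}. hilbert_fun s n I b = m"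
  shows "(\<forall>u :: nat \<Rightarrow> nat. (\<forall>i\<in>{1..s}. d i \<le> int (u i)) \<longrightarrow> hilbert_fun s n I u = m)
    \<and> hilbert_poly s n I = of_nat m"
proof -
  interpret cox_ideal s n I
    using assms(1) by (simp add: homogeneous_ideal_def cox_ideal_def)
  have hom: "\<And>p a. p \<in> I \<Longrightarrow> hom_component s a p \<in> I"
    using assms(1) by (simp add: homogeneous_ideal_def)
  \<comment> \<open>\<open>D\<close> is the set of directions in which persistence has already been applied; in the others
    the degree still lies in the cube.\<close>
  have step: "hilbert_fun s n I u = m"
    if "D \<subseteq> {1..s}" "\<And>i. i \<in> D \<Longrightarrow> d i \<le> int (u i)"
      "\<And>i. i \<in> {1..s} - D \<Longrightarrow> int (u i) \<in> {d i, d i + 1}" for D u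
    using finite_subset[OF that(1) finite_atLeastAtMost] that
  proof (induction D arbitrary: u rule: finite_induct)
    case empty
    then show ?case using assms(5) by simp
  next
    case (insert i D)
    have i: "i \<in> {1..s}" using insert.prems(1) by simp
    define b where "b = nat (d i)"
    have "1 \<le> d i" using assms(2) i by blast
    then have b: "int b = d i" by (simp add: b_def)
    have edge: "hilbert_fun s n I (u(i := c)) = m" if "c \<in> {b, Suc b}" for c
    proof (rule insert.IH)
      show "D \<subseteq> {1..s}" using insert.prems(1) by simp
      show "d j \<le> int ((u(i := c)) j)" if "j \<in> D" for j
        using insert.prems(2)[of j] that insert.hyps(2) by auto
      show "int ((u(i := c)) j) \<in> {d j, d j + 1}" if "j \<in> {1..s} - D" for j
        using insert.prems(3)[of j] that b \<open>c \<in> {b, Suc b}\<close> by auto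
    qed
    have "hilbert_fun s n I (u(i := u i)) = m"
    proof (rule hilbert_fun_persistence[OF hom assms(4) i])
      show "m \<le> b" using assms(3) i b by fastforce
      show "d j \<le> int ((u(i := b)) j)" if "j \<in> {1..s}" for j
        using insert.prems(2)[of j] insert.prems(3)[of j] that b by (cases "j \<in> D") auto
      show "b \<le> u i" using insert.prems(2)[of i] b by simp
    qed (use edge in auto)
    then show ?case by simp
  qed
  have main: "hilbert_fun s n I u = m" if "\<forall>i\<in>{1..s}. d i \<le> int (u i)" for u
    by (rule step[of "{1..s}"]) (use that in auto)
  have "hilbert_poly s n I = of_nat m"
  proof (rule hilbert_poly_eqI[OF of_nat_in_rat_mpolys])
    \<comment> \<open>a common bound for all entries of \<open>d\<close>, obtained as their sum\<close>
    fix u :: "nat \<Rightarrow> nat" assume u: "\<forall>i\<in>{1..s}. nat (\<Sum>i\<in>{1..s}. d i) \<le> u i"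
    have "d i \<le> int (u i)" if "i \<in> {1..s}" for i
    proof -
      have "d i \<le> (\<Sum>i\<in>{1..s}. d i)" using that assms(2) by (intro member_le_sum) fastforce+
      then show ?thesis using u that by fastforce
    qed
    then show "eval_mpoly (of_nat m) (\<lambda>i. of_nat (u i)) = of_nat (hilbert_fun s n I u)"
      using main by (simp add: eval_mpoly_of_nat)
  qed
  then show ?thesis using main by blast
qed

end
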